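(* Let $T_n^{\max}$ denote the size (number of vertices) of the largest tree of the Moran forest $\mathscr{F}_n$. Then, as $n\to\infty$, \[ T_n^{\max} = \alpha\bigl(\log n - (1+o_{\mathrm p}(1))\log\log n\bigr), \] where $\alpha = (1-\log(e-1))^{-1}\approx 2.18019$ and $o_{\mathrm p}(1)$ denotes a sequence of random variables that goes to $0$ in probability.
   Context: Moran forest: for fixed $n\ge 2$, consider the Markov chain on directed graphs on $\{1,\ldots,n\}$ whose transitions are: at each time-step, choose an ordered pair of distinct vertices $(u,v)$ uniformly at random; disconnect $v$ from all of its neighbors (remove all edges incident to $v$), then add the edge $\vec{uv}$. This chain has a unique stationary distribution, whose support is the set of non-empty rooted forests (those with at least one edge) on $\{1,\ldots,n\}$. The Moran forest $\mathscr{F}_n$ is a random forest having this stationary distribution. The trees of the forest are its connected components (isolated vertices count as trees of size 1). *)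

theory Defs
  imports "HOL-Probability.Probability"
begin

text \<open>A directed graph on \<open>{1..n}\<close> is represented by its edge set; the pair \<open>(u, v)\<close> is the
  edge from \<open>u\<close> to \<open>v\<close>.\<close>

type_synonym digraph = "(nat \<times> nat) set"

definition vertex_pairs :: "nat \<Rightarrow> (nat \<times> nat) set" where
  "vertex_pairs n = {(u, v). u \<in> {1..n} \<and> v \<in> {1..n} \<and> u \<noteq> v}"

definition digraphs :: "nat \<Rightarrow> digraph set" where
  "digraphs n = Pow (vertex_pairs n)"

definition disconnect :: "nat \<Rightarrow> digraph \<Rightarrow> digraph" where
  "disconnect v E = {e \<in> E. fst e \<noteq> v \<and> snd e \<noteq> v}"

text \<open>Only meaningful for \<open>n \<ge> 2\<close>, when \<open>vertex_pairs n\<close> is non-empty.\<close>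

definition moran_step :: "nat \<Rightarrow> digraph \<Rightarrow> digraph pmf" where
  "moran_step n E =
     map_pmf (\<lambda>(u, v). insert (u, v) (disconnect v E)) (pmf_of_set (vertex_pairs n))"

definition moran_stationary :: "nat \<Rightarrow> digraph pmf \<Rightarrow> bool" where
  "moran_stationary n \<mu> \<longleftrightarrow> set_pmf \<mu> \<subseteq> digraphs n \<and> bind_pmf \<mu> (moran_step n) = \<mu>"

text \<open>The law of the Moran forest. For \<open>n \<ge> 2\<close> the stationary distribution is unique, because
  a run of steps in which every vertex is disconnected at least once erases the initial graph.\<close>

definition moran_forest :: "nat \<Rightarrow> digraph pmf" where
  "moran_forest n = (THE \<mu>. moran_stationary n \<mu>)"

text \<open>Connected components ignore the orientation of edges; an isolated vertex \<open>v\<close> has the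
  component \<open>{v}\<close>, as the closure is reflexive.\<close>

definition component :: "digraph \<Rightarrow> nat \<Rightarrow> nat set" where
  "component E v = (E \<union> E\<inverse>)\<^sup>* `` {v}"

definition trees :: "nat \<Rightarrow> digraph \<Rightarrow> nat set set" where
  "trees n E = component E ` {1..n}"

definition max_tree_size :: "nat \<Rightarrow> digraph \<Rightarrow> nat" where
  "max_tree_size n E = Max (card ` trees n E)"

text \<open>Convergence to 0 in probability, where the \<open>n\<close>-th variable lives on its own space \<open>M n\<close>.\<close>

definition tendsto_zero_in_prob :: "(nat \<Rightarrow> 'a pmf) \<Rightarrow> (nat \<Rightarrow> 'a \<Rightarrow> real) \<Rightarrow> bool" where
  "tendsto_zero_in_prob M X \<longleftrightarrow>
     (\<forall>\<delta>>0. (\<lambda>n. measure_pmf.prob (M n) {\<omega>. \<bar>X n \<omega>\<bar> > \<delta>}) \<longlonglongrightarrow> 0)"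

definition moran_alpha :: real where
  "moran_alpha = inverse (1 - ln (exp 1 - 1))"

end

theory Submission
  imports Defs "HOL-Real_Asymp.Real_Asymp"
begin

text \<open>
Seen backwards in time, only the last disconnection of each vertex matters. Order the vertices by the
time of their last disconnection, the oldest first. An edge from \<open>u\<close> to \<open>v\<close> survives if and only if the
parent \<open>u\<close> chosen by \<open>v\<close> is older than \<open>v\<close>. The Moran forest is therefore a growing forest: the vertices
arrive one by one, each chooses a parent uniformly among the \<open>N = n - 1\<close> other vertices, joins the tree of the
parent if the parent has already arrived, and founds a new tree otherwise. The law of this growing forest is
\<open>attachment_law\<close>. It is stationary (\<open>stationary_attachment_law\<close>), and the stationary law is unique because a
word of steps that disconnects every vertex erases the initial graph (\<open>stationary_unique\<close>).

In the growing forest a tree of size \<open>s\<close> gains a vertex with probability \<open>s / N\<close> per step. With time measured in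
units of \<open>N\<close> steps, it is close to a Yule process, whose size at time \<open>t\<close> is geometric and exceeds \<open>m\<close> with
probability \<open>(1 - exp (-t)) ^ m\<close>. A vertex that arrives when time \<open>t\<close> is left founds a tree with probability
\<open>t\<close>, so the expected number of trees with more than \<open>m\<close> vertices is about
\<open>n\<close> times the integral of \<open>t (1 - exp (-t)) ^ m\<close> over the unit interval, hence of order
\<open>n (1 - exp (-1)) ^ m / m\<close>. Because \<open>ln (1 - exp (-1))\<close> is \<open>- 1 / \<alpha>\<close>, this passes from large to small where
\<open>m / \<alpha> + ln m\<close> is \<open>ln n\<close>, that is at \<open>m = \<alpha> (ln n - ln (ln n))\<close> up to a bounded error.

For the upper bound, the expected numbers of trees of size at least \<open>x\<close> satisfy a linear recursion in \<open>x\<close>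
and the number of vertices; \<open>expected_large_trees\<close> bounds them by an explicit supersolution. For the lower
bound, the probability that all trees stay below size \<open>x\<close> is at most what it would be if the trees grew
independently, because they compete for the arriving vertices: \<open>expected_survival\<close> proves this with a product
over the trees that is a supermartingale, so no second moment is computed. The growth of one tree is
estimated from below in \<open>reach_lower_bound\<close>.
\<close>

section \<open>The attachment law and its invariance under a step\<close>

text \<open>Keeping the edge only if \<open>u \<in> A\<close> encodes the order of the vertices: \<open>A\<close> holds the vertices disconnected
no later than \<open>w\<close>, and a parent outside \<open>A\<close> was disconnected after \<open>w\<close>, which destroyed the edge.\<close>

definition attach :: "nat set \<Rightarrow> nat \<Rightarrow> nat \<Rightarrow> digraph \<Rightarrow> digraph" where
  "attach A u w E = (if u \<in> A then insert (u, w) E else E)"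

text \<open>Here \<open>w\<close> is the most recently disconnected vertex of \<open>A\<close>. Drawing it first, and the forest on the older
vertices independently afterwards, makes the recursion run along the age of the forest: each unfolding adds
one vertex to a forest on a smaller set, which is what both the invariance proof and the growth estimates use.
The counter \<open>k\<close> stands for \<open>card A\<close> and only serves to make the recursion primitive.\<close>

primrec attachment_law :: "nat set \<Rightarrow> nat \<Rightarrow> nat set \<Rightarrow> digraph pmf" where
  "attachment_law V 0 A = return_pmf {}"
| "attachment_law V (Suc k) A =
     pmf_of_set A \<bind> (\<lambda>w. pmf_of_set (V - {w}) \<bind> (\<lambda>u.
       map_pmf (attach A u w) (attachment_law V k (A - {w}))))"

lemma card_remove_Suc:
  assumes "card A = Suc k" "w \<in> A"
  shows "card (A - {w}) = k"
  using assms by (simp add: card_Diff_singleton)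

lemma Diff_singleton_nonempty:
  assumes "card V \<ge> 2"
  shows "V - {w} \<noteq> {}"
  using assms card_mono[of "{w}" V] by (auto simp: Diff_eq_empty_iff)

lemma attachment_law_support:
  assumes "card V \<ge> 2" "A \<subseteq> V" "card A = k" "E \<in> set_pmf (attachment_law V k A)"
  shows "E \<subseteq> {(u, v). u \<in> A \<and> v \<in> A \<and> u \<noteq> v}"
  using assms(2-)
proof (induction k arbitrary: A E)
  case 0
  then show ?case by simp
next
  case (Suc k)
  have fin: "finite V" "finite A" "A \<noteq> {}"
    using assms(1) Suc.prems by (auto intro!: card_ge_0_finite)
  from Suc.prems(3) obtain w u E' where w: "w \<in> A" and u: "u \<in> V - {w}"
    and E': "E' \<in> set_pmf (attachment_law V k (A - {w}))" and E: "E = attach A u w E'"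
    using fin Diff_singleton_nonempty[OF assms(1)]
    by (auto simp: set_pmf_of_set)
  have "E' \<subseteq> {(u, v). u \<in> A - {w} \<and> v \<in> A - {w} \<and> u \<noteq> v}"
    using Suc.IH[OF _ _ E'] Suc.prems w by auto
  then show ?case
    using w u by (auto simp: E attach_def)
qed

lemma finite_attachment_law:
  assumes "card V \<ge> 2" "A \<subseteq> V" "card A = k"
  shows "finite (set_pmf (attachment_law V k A))"
proof -
  have "finite A" using assms by (meson card_ge_0_finite finite_subset less_le_trans pos2)
  then have "finite (Pow (A \<times> A))" by simp
  moreover have "set_pmf (attachment_law V k A) \<subseteq> Pow (A \<times> A)"
    using attachment_law_support[OF assms] by fast
  ultimately show ?thesis by (rule rev_finite_subset)
qed

text \<open>With probability \<open>1 / card A\<close> the draw is \<open>v\<close>, and otherwise it is uniform on the rest; if both alternatives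
lead to the same law, so does the mixture.\<close>

lemma bind_pmf_of_set_absorb:
  assumes "finite A" "v \<in> A" "f v = M"
    and "A \<noteq> {v} \<Longrightarrow> pmf_of_set (A - {v}) \<bind> f = M"
  shows "pmf_of_set A \<bind> f = M"
proof (cases "A = {v}")
  case True
  then show ?thesis using assms(3) by (simp add: pmf_of_set_singleton bind_return_pmf)
next
  case False
  then have ne: "A - {v} \<noteq> {}" using assms(2) by auto
  define d where "d = card (A - {v})"
  have c: "card A = Suc d" "d > 0"
    using assms ne by (auto simp: card_gt_0_iff card.remove d_def simp del: card_Diff_insert)
  show ?thesis
  proof (rule pmf_eqI)
    fix i
    have "pmf M i = (\<Sum>w\<in>A - {v}. pmf (f w) i) / d"
      using pmf_bind_pmf_of_set[OF ne, of f i] assms(1) assms(4)[OF False] unfolding d_def by auto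
    then have s: "(\<Sum>w\<in>A - {v}. pmf (f w) i) = pmf M i * d"
      using c by (simp add: field_simps)
    have "pmf (pmf_of_set A \<bind> f) i = (\<Sum>w\<in>A. pmf (f w) i) / card A"
      using assms(1,2) pmf_bind_pmf_of_set[of A f i] by blast
    also have "(\<Sum>w\<in>A. pmf (f w) i) = pmf M i * card A"
      using assms s c(1) by (simp add: sum.remove[of A v] algebra_simps)
    finally show "pmf (pmf_of_set A \<bind> f) i = pmf M i"
      using c by simp
  qed
qed

lemma disconnect_attach_same:
  assumes "E \<subseteq> (A - {v}) \<times> (A - {v})"
  shows "disconnect v (attach A u v E) = E"
  using assms by (auto simp: disconnect_def attach_def)

lemma disconnect_attach_other:
  assumes "v \<noteq> w"
  shows "disconnect v (attach A u w E) = attach (A - {v}) u w (disconnect v E)"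
  using assms by (auto simp: disconnect_def attach_def)

text \<open>Forgetting a vertex leaves the attachment law of the remaining ones: if the forgotten vertex is the youngest,
nothing else was attached to it; if not, the youngest vertex is still uniform among the others, and forgetting
\<open>v\<close> commutes with attaching it.\<close>

lemma disconnect_attachment_law:
  assumes "card V \<ge> 2" "A \<subseteq> V" "card A = Suc k" "v \<in> A"
  shows "map_pmf (disconnect v) (attachment_law V (Suc k) A) = attachment_law V k (A - {v})"
  using assms(2-)
proof (induction k arbitrary: A)
  case 0
  then have A: "A = {v}" by (metis One_nat_def card_1_singletonE singletonD)
  have "disconnect v (attach {v} u v {}) = {}" for u
    by (auto simp: disconnect_def attach_def)
  then show ?case unfolding A
    by (simp add: pmf_of_set_singleton bind_return_pmf map_bind_pmf map_return_pmf)
next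
  case (Suc k)
  have fin: "finite V" "finite A"
    using assms(1) Suc.prems by (auto intro!: card_ge_0_finite)
  let ?L = "attachment_law V"
  let ?f = "\<lambda>w. pmf_of_set (V - {w}) \<bind> (\<lambda>u.
       map_pmf (disconnect v) (map_pmf (attach A u w) (?L (Suc k) (A - {w}))))"
  have unf: "map_pmf (disconnect v) (?L (Suc (Suc k)) A) = pmf_of_set A \<bind> ?f"
    by (simp only: attachment_law.simps(2)[of V "Suc k"] map_bind_pmf)
  show ?case unfolding unf
  proof (rule bind_pmf_of_set_absorb[OF fin(2) Suc.prems(3)])
    have "map_pmf (disconnect v) (map_pmf (attach A u v) (?L (Suc k) (A - {v})))
        = ?L (Suc k) (A - {v})" for u
    proof -
      have "map_pmf (disconnect v \<circ> attach A u v) (?L (Suc k) (A - {v}))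
        = map_pmf id (?L (Suc k) (A - {v}))"
      proof (rule map_pmf_cong[OF refl])
        fix E assume E: "E \<in> set_pmf (?L (Suc k) (A - {v}))"
        have "E \<subseteq> (A - {v}) \<times> (A - {v})"
          using attachment_law_support[OF assms(1) _ _ E] Suc.prems by auto
        then show "(disconnect v \<circ> attach A u v) E = id E"
          by (simp add: disconnect_attach_same)
      qed
      then show ?thesis by (simp add: map_pmf_comp o_def)
    qed
    then show "?f v = ?L (Suc k) (A - {v})" by simp
  next
    have step: "map_pmf (disconnect v) (map_pmf (attach A u w) (?L (Suc k) (A - {w})))
        = map_pmf (attach (A - {v}) u w) (?L k (A - {v} - {w}))" if w: "w \<in> A - {v}" for u w
    proof -
      have "map_pmf (disconnect v) (map_pmf (attach A u w) (?L (Suc k) (A - {w})))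
          = map_pmf (attach (A - {v}) u w) (map_pmf (disconnect v) (?L (Suc k) (A - {w})))"
        using w by (auto simp only: map_pmf_comp disconnect_attach_other intro!: map_pmf_cong)
      also have "map_pmf (disconnect v) (?L (Suc k) (A - {w})) = ?L k (A - {w} - {v})"
        using w Suc.prems by (intro Suc.IH) auto
      also have "A - {w} - {v} = A - {v} - {w}" by auto
      finally show ?thesis .
    qed
    have "card (A - {v}) = Suc k" using Suc.prems by (intro card_remove_Suc)
    then have "A - {v} \<noteq> {}" by (metis card.empty nat.distinct(1))
    then have sp: "set_pmf (pmf_of_set (A - {v})) = A - {v}"
      using fin(2) set_pmf_of_set[of "A - {v}"] by auto
    show "pmf_of_set (A - {v}) \<bind> ?f = ?L (Suc k) (A - {v})"
      unfolding attachment_law.simps(2)[of V k "A - {v}"]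
    proof (intro bind_pmf_cong refl)
      fix w u assume "w \<in> set_pmf (pmf_of_set (A - {v}))"
      then show "map_pmf (disconnect v) (map_pmf (attach A u w) (?L (Suc k) (A - {w})))
        = map_pmf (attach (A - {v}) u w) (?L k (A - {v} - {w}))"
        unfolding sp by (rule step)
    qed
  qed
qed

lemma vertex_pairs_finite: "finite (vertex_pairs n)"
  by (rule finite_subset[of _ "{1..n} \<times> {1..n}"]) (auto simp: vertex_pairs_def)

lemma vertex_pairs_nonempty: "n \<ge> 2 \<Longrightarrow> vertex_pairs n \<noteq> {}"
  using equals0D[of "vertex_pairs n" "(1, 2)"] by (auto simp: vertex_pairs_def)

lemma pmf_of_set_vertex_pairs:
  assumes "n \<ge> 2"
  shows "pmf_of_set (vertex_pairs n) =
    pmf_of_set {1..n} \<bind> (\<lambda>v. map_pmf (\<lambda>u. (u, v)) (pmf_of_set ({1..n} - {v})))"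
proof -
  have "vertex_pairs n = (\<lambda>(v, u). (u, v)) ` (SIGMA v:{1..n}. {1..n} - {v})"
    by (auto simp: vertex_pairs_def)
  moreover have "card (\<dots>) = n * (n - 1)"
    by (subst card_image) (auto simp: inj_on_def)
  ultimately have cd: "card (vertex_pairs n) = n * (n - 1)" by simp
  note ne = vertex_pairs_nonempty[OF assms]
  have ne': "{1..n} - {v} \<noteq> {}" for v
    using assms by (intro Diff_singleton_nonempty) auto
  show ?thesis
  proof (rule pmf_eqI, safe)
    fix u v :: nat
    have "pmf (map_pmf (\<lambda>u. (u, w)) (pmf_of_set ({1..n} - {w}))) (u, v) =
      (if w = v \<and> (u, v) \<in> vertex_pairs n then 1 / (n - 1) else 0)" if "w \<in> {1..n}" for w
    proof (cases "w = v")
      case True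
      have "pmf (map_pmf (\<lambda>u. (u, v)) (pmf_of_set ({1..n} - {v}))) (u, v) 
        = pmf (pmf_of_set ({1..n} - {v})) u"
        by (rule pmf_map_inj') (auto simp: inj_on_def)
      then show ?thesis using True that ne'[of v]
        by (auto simp: indicator_def vertex_pairs_def)
    next
      case False
      then show ?thesis by (auto simp: pmf_eq_0_set_pmf)
    qed
    then have "(\<Sum>w\<in>{1..n}. pmf (map_pmf (\<lambda>u. (u, w)) (pmf_of_set ({1..n} - {w}))) (u, v))
       = (\<Sum>w\<in>{1..n}. if w = v then (if (u, v) \<in> vertex_pairs n then 1 / (n - 1) else 0) else 0)"
      by (intro sum.cong) auto
    also have "\<dots> = (if (u, v) \<in> vertex_pairs n then 1 / (n - 1) else 0)"
      by (subst sum.delta) (auto simp: vertex_pairs_def)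
    finally show "pmf (pmf_of_set (vertex_pairs n)) (u, v) = pmf (pmf_of_set {1..n} \<bind>
        (\<lambda>v. map_pmf (\<lambda>u. (u, v)) (pmf_of_set ({1..n} - {v})))) (u, v)"
      using assms ne vertex_pairs_finite[of n]
      by (simp add: pmf_bind_pmf_of_set cd)
  qed
qed

text \<open>One step of the chain disconnects a uniform vertex \<open>v\<close>, which leaves the attachment law on the other vertices
by \<open>disconnect_attachment_law\<close>, and then attaches \<open>v\<close> to a uniform other vertex. Literally these are the instructions that
define the attachment law on all vertices with \<open>v\<close> as the youngest one.\<close>

lemma stationary_attachment_law:
  assumes n: "n \<ge> 2"
  shows "moran_stationary n (attachment_law {1..n} n {1..n})"
  unfolding moran_stationary_def
proof
  let ?V = "{1..n}"
  let ?L = "attachment_law ?V n ?V"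
  show "set_pmf ?L \<subseteq> digraphs n"
    using attachment_law_support[of ?V ?V n] n by (fastforce simp: digraphs_def vertex_pairs_def)
  obtain k where k: "n = Suc k" using n by (cases n) auto
  have "?L \<bind> moran_step n = pmf_of_set (vertex_pairs n) \<bind>
     (\<lambda>(u, v). map_pmf (\<lambda>E. insert (u, v) (disconnect v E)) ?L)"
    unfolding moran_step_def map_pmf_def by (subst bind_commute_pmf) (simp add: case_prod_unfold)
  also have "\<dots> = pmf_of_set ?V \<bind> (\<lambda>v. pmf_of_set (?V - {v}) \<bind> (\<lambda>u.
       map_pmf (insert (u, v)) (map_pmf (disconnect v) ?L)))"
    by (simp add: pmf_of_set_vertex_pairs[OF n] bind_assoc_pmf bind_map_pmf map_pmf_comp)
  also have "\<dots> = pmf_of_set ?V \<bind> (\<lambda>v. pmf_of_set (?V - {v}) \<bind> (\<lambda>u.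
       map_pmf (attach ?V u v) (attachment_law ?V k (?V - {v}))))"
  proof (intro bind_pmf_cong refl)
    fix v u assume "v \<in> set_pmf (pmf_of_set ?V)" "u \<in> set_pmf (pmf_of_set (?V - {v}))"
    moreover have "?V - {v} \<noteq> {}" using n by (intro Diff_singleton_nonempty) auto
    ultimately have vu: "v \<in> ?V" "u \<in> ?V - {v}" using n by (auto simp: set_pmf_of_set)
    have "map_pmf (disconnect v) ?L = attachment_law ?V k (?V - {v})"
      unfolding k using n k vu by (intro disconnect_attachment_law) auto
    moreover have "insert (u, v) = attach ?V u v" using vu by (auto simp: attach_def)
    ultimately show "map_pmf (insert (u, v)) (map_pmf (disconnect v) ?L)
      = map_pmf (attach ?V u v) (attachment_law ?V k (?V - {v}))" by simp
  qed
  also have "\<dots> = ?L" by (simp add: k)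
  finally show "?L \<bind> moran_step n = ?L" .
qed

section \<open>Uniqueness of the stationary law\<close>

abbreviation run :: "(nat \<times> nat) list \<Rightarrow> digraph \<Rightarrow> digraph" where
  "run \<equiv> fold (\<lambda>(u, v) E. insert (u, v) (disconnect v E))"

text \<open>A step makes the edges at the disconnected vertex equal, so afterwards the two graphs differ at most at the
vertices of \<open>S\<close> and at those that are still to be disconnected.\<close>

lemma run_forgets:
  "{e \<in> run w E. fst e \<notin> S \<and> snd e \<notin> S} = {e \<in> run w E'. fst e \<notin> S \<and> snd e \<notin> S}"
  if "{e \<in> E. fst e \<notin> S \<union> snd ` set w \<and> snd e \<notin> S \<union> snd ` set w} =
      {e \<in> E'. fst e \<notin> S \<union> snd ` set w \<and> snd e \<notin> S \<union> snd ` set w}"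
  using that
proof (induction w arbitrary: E E')
  case Nil
  then show ?case by simp
next
  case (Cons p w)
  obtain u v where p: "p = (u, v)" by fastforce
  let ?g = "\<lambda>E. insert (u, v) (disconnect v E)"
  have "{e \<in> ?g E. fst e \<notin> S \<union> snd ` set w \<and> snd e \<notin> S \<union> snd ` set w} =
      {e \<in> ?g E'. fst e \<notin> S \<union> snd ` set w \<and> snd e \<notin> S \<union> snd ` set w}"
    using Cons.prems by (auto simp: p disconnect_def set_eq_iff)
  from Cons.IH[OF this] show ?case by (simp add: p)
qed

lemma run_covering:
  assumes "snd ` set w = {1..n}" "E \<in> digraphs n" "E' \<in> digraphs n"
  shows "run w E = run w E'"
  using run_forgets[of E "{}" w E'] assms by (fastforce simp: digraphs_def vertex_pairs_def)

lemma stationary_run: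
  assumes "bind_pmf \<mu> (moran_step n) = \<mu>"
  shows "replicate_pmf k (pmf_of_set (vertex_pairs n)) \<bind> (\<lambda>w. map_pmf (run w) \<mu>) = \<mu>"
proof (induction k)
  case 0
  then show ?case by (simp add: bind_return_pmf map_pmf_ident)
next
  case (Suc k)
  let ?P = "pmf_of_set (vertex_pairs n)" and ?W = "replicate_pmf k (pmf_of_set (vertex_pairs n))"
  let ?g = "\<lambda>p E. insert p (disconnect (snd p) E)"
  have "replicate_pmf (Suc k) ?P \<bind> (\<lambda>w. map_pmf (run w) \<mu>)
     = ?P \<bind> (\<lambda>p. ?W \<bind> (\<lambda>w. map_pmf (run w) (map_pmf (?g p) \<mu>)))"
    by (simp add: bind_assoc_pmf bind_return_pmf map_pmf_comp case_prod_unfold o_def)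
  also have "\<dots> = ?W \<bind> (\<lambda>w. ?P \<bind> (\<lambda>p. map_pmf (run w) (map_pmf (?g p) \<mu>)))"
    by (rule bind_commute_pmf)
  also have "\<dots> = ?W \<bind> (\<lambda>w. map_pmf (run w) (?P \<bind> (\<lambda>p. map_pmf (?g p) \<mu>)))"
    by (simp add: map_bind_pmf)
  also have "?P \<bind> (\<lambda>p. map_pmf (?g p) \<mu>) = \<mu> \<bind> moran_step n"
    unfolding moran_step_def map_pmf_def
    by (subst bind_commute_pmf) (simp add: case_prod_unfold)
  finally show ?case using Suc assms by simp
qed

lemma measure_bind_pmf_integral:
  "measure_pmf.prob (M \<bind> f) A = (\<integral>x. measure_pmf.prob (f x) A \<partial>measure_pmf M)"
proof -
  have int: "integrable (measure_pmf M) (\<lambda>x. measure_pmf.prob (f x) A)"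
    by (rule measure_pmf.integrable_const_bound[where B = 1]) auto
  have "ennreal (measure_pmf.prob (M \<bind> f) A) = (\<integral>\<^sup>+x. ennreal (measure_pmf.prob (f x) A) \<partial>measure_pmf M)"
    by (simp only: measure_pmf.emeasure_eq_measure[symmetric] emeasure_bind_pmf)
  also have "\<dots> = ennreal (\<integral>x. measure_pmf.prob (f x) A \<partial>measure_pmf M)"
    using int by (intro nn_integral_eq_integral) auto
  finally show ?thesis
    by (subst (asm) ennreal_inj) (auto intro!: integral_nonneg)
qed

text \<open>A Doeblin argument. A fixed word that disconnects every vertex once sends all initial graphs to the same
graph, so on the event that the next \<open>n\<close> steps spell this word two stationary laws are coupled; each block of
\<open>n\<close> steps therefore shrinks their difference by the factor \<open>c\<close>, one minus the probability of the word.\<close>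

lemma stationary_close:
  assumes n: "n \<ge> 2" and st: "moran_stationary n \<mu>" "moran_stationary n \<nu>"
  shows "\<exists>c<1. \<forall>j A. \<bar>measure_pmf.prob \<mu> A - measure_pmf.prob \<nu> A\<bar> \<le> c ^ j"
proof -
  let ?P = "pmf_of_set (vertex_pairs n)"
  define W where "W = replicate_pmf n ?P"
  \<comment> \<open>every vertex is disconnected once; its parent is vertex 1, or 2 for vertex 1 itself\<close>
  define ws where "ws = map (\<lambda>v. (if v = 1 then 2 else 1::nat, v)) [1..<Suc n]"
  have cov: "snd ` set ws = {1..n}" by (auto simp: ws_def image_image)
  note ne = vertex_pairs_nonempty[OF n]
  have "set ws \<subseteq> vertex_pairs n" using n by (auto simp: ws_def vertex_pairs_def split: if_splits)
  then have "ws \<in> set_pmf W"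
    unfolding W_def set_replicate_pmf set_pmf_of_set[OF ne vertex_pairs_finite]
    by (simp add: lists_eq_set) (simp add: ws_def)
  then have pos: "pmf W ws > 0" by (simp add: pmf_positive)
  define c where "c = 1 - pmf W ws"
  have dg: "set_pmf \<mu> \<subseteq> digraphs n" "set_pmf \<nu> \<subseteq> digraphs n"
    using st by (auto simp: moran_stationary_def)
  have eq: "measure_pmf.prob \<mu>' A = (\<integral>w. measure_pmf.prob \<mu>' (run w -` A) \<partial>measure_pmf W)"
    if "moran_stationary n \<mu>'" for \<mu>' A
  proof -
    have "\<mu>' = W \<bind> (\<lambda>w. map_pmf (run w) \<mu>')"
      using stationary_run[of \<mu>' n n] that by (simp add: W_def moran_stationary_def)
    then have "measure_pmf.prob \<mu>' A = measure_pmf.prob (W \<bind> (\<lambda>w. map_pmf (run w) \<mu>')) A" by simp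
    also have "\<dots> = (\<integral>w. measure_pmf.prob (map_pmf (run w) \<mu>') A \<partial>measure_pmf W)"
      by (rule measure_bind_pmf_integral)
    finally show ?thesis by simp
  qed
  have same: "measure_pmf.prob \<mu> (run ws -` A) = measure_pmf.prob \<nu> (run ws -` A)" for A
  proof -
    have "measure_pmf.prob \<mu>' (run ws -` A) = of_bool (run ws {} \<in> A)"
      if "set_pmf \<mu>' \<subseteq> digraphs n" for \<mu>' :: "digraph pmf"
    proof -
      have const: "run ws E = run ws {}" if "E \<in> set_pmf \<mu>'" for E
        using run_covering[OF cov, of E "{}"] that \<open>set_pmf \<mu>' \<subseteq> digraphs n\<close>
        by (auto simp: digraphs_def)
      show ?thesis
      proof (cases "run ws {} \<in> A")
        case True
        then show ?thesis
          using const by (auto simp: measure_pmf.prob_eq_1 AE_measure_pmf_iff)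
      next
        case False
        then show ?thesis
          using const by (auto simp: measure_pmf_zero_iff)
      qed
    qed
    then show ?thesis using dg by simp
  qed
  have "\<bar>measure_pmf.prob \<mu> A - measure_pmf.prob \<nu> A\<bar> \<le> c ^ j" for j A
  proof (induction j arbitrary: A)
    case 0
    show ?case unfolding power_0
      using measure_pmf.prob_le_1[of \<mu> A] measure_pmf.prob_le_1[of \<nu> A]
        measure_nonneg[of \<mu> A] measure_nonneg[of \<nu> A] by linarith
  next
    case (Suc j)
    let ?d = "\<lambda>w. measure_pmf.prob \<mu> (run w -` A) - measure_pmf.prob \<nu> (run w -` A)"
    have int: "integrable (measure_pmf W) f" if "\<And>w. \<bar>f w\<bar> \<le> 1" for f :: "_ \<Rightarrow> real"
      using that by (intro measure_pmf.integrable_const_bound[where B = 1]) auto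
    have ip: "integrable (measure_pmf W) (\<lambda>w. measure_pmf.prob \<mu>' (run w -` A))" for \<mu>' :: "digraph pmf"
      by (rule int) auto
    have "\<bar>measure_pmf.prob \<mu> A - measure_pmf.prob \<nu> A\<bar> = \<bar>\<integral>w. ?d w \<partial>measure_pmf W\<bar>"
      using ip by (simp add: eq[OF st(1), of A] eq[OF st(2), of A])
    also have "\<dots> \<le> (\<integral>w. \<bar>?d w\<bar> \<partial>measure_pmf W)" by simp
    also have "\<dots> \<le> (\<integral>w. c ^ j * indicator (- {ws}) w \<partial>measure_pmf W)"
    proof (rule integral_mono)
      show "integrable (measure_pmf W) (\<lambda>w. \<bar>?d w\<bar>)" using ip by simp
      show "integrable (measure_pmf W) (\<lambda>w. c ^ j * indicator (- {ws}) w :: real)"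
        by (intro integrable_mult_right int) (auto simp: indicator_def)
      show "\<bar>?d w\<bar> \<le> c ^ j * indicator (- {ws}) w" for w
        using Suc[of "run w -` A"] same[of A] by (auto simp: indicator_def)
    qed
    also have "\<dots> = c ^ j * measure_pmf.prob W (- {ws})" by simp
    also have "measure_pmf.prob W (- {ws}) = c"
      by (subst measure_pmf.prob_compl[of "{ws}" W, simplified, folded Compl_eq_Diff_UNIV])
        (simp add: c_def pmf.rep_eq)
    finally show ?case by (simp add: mult.commute)
  qed
  moreover have "c < 1" using pos by (simp add: c_def)
  ultimately show ?thesis by blast
qed

lemma stationary_unique:
  assumes "n \<ge> 2" "moran_stationary n \<mu>" "moran_stationary n \<nu>"
  shows "\<mu> = \<nu>"
proof (rule pmf_eqI)
  fix E
  obtain c where c: "c < 1" "\<And>j A. \<bar>measure_pmf.prob \<mu> A - measure_pmf.prob \<nu> A\<bar> \<le> c ^ j"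
    using stationary_close[OF assms] by blast
  have "c \<ge> 0" using c(2)[of "{}" 1] by simp
  then have "(\<lambda>j. c ^ j) \<longlonglongrightarrow> 0" using c(1) by (simp add: LIMSEQ_realpow_zero)
  then have "\<bar>pmf \<mu> E - pmf \<nu> E\<bar> \<le> 0"
    using c(2)[of "{E}"] by (intro LIMSEQ_le_const[of "\<lambda>j. c ^ j"]) (auto simp: measure_pmf_single)
  then show "pmf \<mu> E = pmf \<nu> E" by simp
qed

lemma moran_forest_eq:
  assumes "n \<ge> 2"
  shows "moran_forest n = attachment_law {1..n} n {1..n}"
  unfolding moran_forest_def
  using stationary_attachment_law[OF assms] stationary_unique[OF assms] by blast

section \<open>Components after an attachment\<close>

lemma component_self: "x \<in> component E x"
  by (simp add: component_def)

lemma component_eq: "y \<in> component E x \<Longrightarrow> component E y = component E x"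
proof -
  have sym: "(b, a) \<in> (E \<union> E\<inverse>)\<^sup>*" if "(a, b) \<in> (E \<union> E\<inverse>)\<^sup>*" for a b
    using that by (meson sym_Un_converse sym_rtrancl symD)
  assume "y \<in> component E x"
  then show ?thesis
    by (auto simp: component_def dest: sym intro: rtrancl_trans)
qed

lemma component_mono: "E \<subseteq> F \<Longrightarrow> component E x \<subseteq> component F x"
  unfolding component_def by (intro Image_mono rtrancl_mono) auto

lemma component_least:
  assumes "x \<in> D" "\<And>u v. (u, v) \<in> E \<Longrightarrow> u \<in> D \<longleftrightarrow> v \<in> D"
  shows "component E x \<subseteq> D"
proof
  fix y assume "y \<in> component E x"
  then have "(x, y) \<in> (E \<union> E\<inverse>)\<^sup>*" by (simp add: component_def)
  then show "y \<in> D" using assms by induction auto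
qed

lemma component_closed:
  assumes "(u, v) \<in> E"
  shows "u \<in> component E x \<longleftrightarrow> v \<in> component E x"
proof -
  have "(u, v) \<in> (E \<union> E\<inverse>)\<^sup>*" "(v, u) \<in> (E \<union> E\<inverse>)\<^sup>*" using assms by auto
  then show ?thesis by (auto simp: component_def intro: rtrancl_trans)
qed

lemma component_subset: "E \<subseteq> A \<times> A \<Longrightarrow> x \<in> A \<Longrightarrow> component E x \<subseteq> A"
  by (rule component_least) auto

lemma component_isolated: "E \<subseteq> A \<times> A \<Longrightarrow> w \<notin> A \<Longrightarrow> component E w = {w}"
  using component_least[of w "{w}" E] component_self[of w E] by blast

lemma components_attach_root:
  assumes "E \<subseteq> A \<times> A" "w \<notin> A"
  shows "component E ` insert w A = insert {w} (component E ` A)"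
  using component_isolated[OF assms] by simp

lemma components_attach_child:
  assumes E: "E \<subseteq> A \<times> A" and w: "w \<notin> A" and u: "u \<in> A"
  shows "component (insert (u, w) E) ` insert w A
    = insert (insert w (component E u)) (component E ` A - {component E u})"
proof -
  let ?F = "insert (u, w) E" and ?C = "component E u"
  have C: "component ?F u = insert w ?C"
  proof
    show "component ?F u \<subseteq> insert w ?C"
    proof (rule component_least)
      show "u \<in> insert w ?C" using component_self by auto
      fix a b assume "(a, b) \<in> ?F"
      then show "a \<in> insert w ?C \<longleftrightarrow> b \<in> insert w ?C"
        using component_closed[of a b E u] component_self[of u E] E w by auto
    qed
    have "w \<in> component ?F u"
      using component_closed[of u w ?F u] component_self[of u ?F] by auto
    then show "insert w ?C \<subseteq> component ?F u"
      using component_mono[of E ?F u] by auto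
  qed
  then have inC: "component ?F x = insert w ?C" if "x \<in> insert w ?C" for x
    using component_eq[of x ?F u] that by simp
  have notC: "component ?F x = component E x" if "x \<in> A - ?C" for x
  proof
    have "w \<notin> component E x" using component_subset[OF E, of x] that w by auto
    moreover have "u \<notin> component E x"
      using component_eq[of u E x] component_self[of x E] that by auto
    ultimately show "component ?F x \<subseteq> component E x"
      using component_closed[of _ _ E x] by (intro component_least component_self) auto
  qed (rule component_mono, auto)
  have "component ?F ` insert w A = component ?F ` insert w ?C \<union> component ?F ` (A - ?C)"
    using component_subset[OF E u] by auto
  also have "component ?F ` insert w ?C = {insert w ?C}" using inC by auto
  also have "component ?F ` (A - ?C) = component E ` (A - ?C)" using notC by auto
  also have "component E ` (A - ?C) = component E ` A - {?C}"
  proof -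
    have "component E x = ?C \<longleftrightarrow> x \<in> ?C" for x
      using component_eq[of x E u] component_self[of x E] by metis
    then show ?thesis by auto
  qed
  finally show ?thesis by simp
qed

lemma components_partition:
  assumes "E \<subseteq> A \<times> A"
  shows "\<Union>(component E ` A) = A"
    and "T \<in> component E ` A \<Longrightarrow> T' \<in> component E ` A \<Longrightarrow> T \<noteq> T' \<Longrightarrow> T \<inter> T' = {}"
    and "u \<in> T \<Longrightarrow> T \<in> component E ` A \<Longrightarrow> component E u = T"
proof -
  show 1: "\<Union>(component E ` A) = A"
    using component_subset[OF assms] component_self[of _ E] by fast
  show 2: "component E u = T" if "u \<in> T" "T \<in> component E ` A" for u T
    using that component_eq by fast
  show "T \<inter> T' = {}" if "T \<in> component E ` A" "T' \<in> component E ` A" "T \<noteq> T'"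
    using that 2 by blast
qed

lemma sum_over_components:
  fixes f :: "nat \<Rightarrow> 'b :: comm_semiring_1"
  assumes "E \<subseteq> A \<times> A" "finite A" "\<And>T u. T \<in> component E ` A \<Longrightarrow> u \<in> T \<Longrightarrow> f u = g T"
  shows "(\<Sum>u\<in>A. f u) = (\<Sum>T\<in>component E ` A. of_nat (card T) * g T)"
proof -
  let ?T = "component E ` A"
  have "sum f (\<Union>?T) = (\<Sum>T\<in>?T. sum f T)"
    using components_partition(1,2)[OF assms(1)] assms(2)
    by (subst sum.Union_disjoint) (auto intro: finite_subset)
  also have "\<dots> = (\<Sum>T\<in>?T. of_nat (card T) * g T)"
    using assms(3) by (intro sum.cong refl) simp
  finally show ?thesis using components_partition(1)[OF assms(1)] by simp
qed

text \<open>A uniform parent \<open>u\<close> hits a given tree with probability proportional to its size; all \<open>u\<close> outside \<open>A\<close> make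
\<open>w\<close> the root of a new tree. Thus the sizes of the trees form a Markov chain by themselves.\<close>

lemma sum_attach:
  fixes \<Psi> :: "nat set set \<Rightarrow> real"
  assumes V: "finite V" and A: "A \<subseteq> V" "w \<in> V - A" and E: "E \<subseteq> A \<times> A"
  defines "\<T> \<equiv> component E ` A"
  shows "(\<Sum>u\<in>V - {w}. \<Psi> (component (attach (insert w A) u w E) ` insert w A)) =
     (\<Sum>T\<in>\<T>. card T * \<Psi> (insert (insert w T) (\<T> - {T})))
     + (real (card V - 1) - card A) * \<Psi> (insert {w} \<T>)"
proof -
  let ?h = "\<lambda>u. \<Psi> (component (attach (insert w A) u w E) ` insert w A)"
  have fin: "finite A" using A V by (auto intro: finite_subset)
  have w: "w \<notin> A" using A by auto
  have child: "?h u = \<Psi> (insert (insert w T) (\<T> - {T}))" if "T \<in> \<T>" "u \<in> T" for u T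
  proof -
    have "u \<in> A" using that components_partition(1)[OF E] by (auto simp: \<T>_def)
    moreover have "component E u = T" using that unfolding \<T>_def by (intro components_partition(3)[OF E])
    ultimately show ?thesis
      using components_attach_child[OF E w, of u] by (simp add: attach_def \<T>_def)
  qed
  have "(\<Sum>u\<in>V - {w}. ?h u) = (\<Sum>u\<in>A. ?h u) + (\<Sum>u\<in>V - {w} - A. ?h u)"
    using A V by (subst sum.subset_diff[of A]) (auto simp: add.commute)
  also have "(\<Sum>u\<in>A. ?h u) = (\<Sum>T\<in>\<T>. real (card T) * \<Psi> (insert (insert w T) (\<T> - {T})))"
    unfolding \<T>_def by (rule sum_over_components[OF E fin]) (use child in \<open>auto simp: \<T>_def\<close>)
  also have "(\<Sum>u\<in>V - {w} - A. ?h u) = (\<Sum>u\<in>V - {w} - A. \<Psi> (insert {w} \<T>))"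
  proof (intro sum.cong refl)
    fix u assume "u \<in> V - {w} - A"
    then have "attach (insert w A) u w E = E" by (auto simp: attach_def)
    then show "?h u = \<Psi> (insert {w} \<T>)"
      using components_attach_root[OF E w] by (simp add: \<T>_def)
  qed
  also have "real (card (V - {w} - A)) = real (card V - 1) - card A"
  proof -
    have "card (V - {w} - A) = card V - 1 - card A" "card A \<le> card V - 1"
      using A V fin card_mono[of "V - {w}" A] card_Diff_subset[of A "V - {w}"] by auto
    then show ?thesis by simp
  qed
  then have "(\<Sum>u\<in>V - {w} - A. \<Psi> (insert {w} \<T>)) = (real (card V - 1) - card A) * \<Psi> (insert {w} \<T>)"
    by simp
  finally show ?thesis .
qed

text \<open>The recursion for expectations in the form of an inequality: averaging \<open>h\<close> over the parent is compared with a
functional \<open>g\<close> of the forest without its youngest vertex. The bound does not depend on which vertex is the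
youngest.\<close>

lemma expectation_attachment_le:
  fixes h :: "digraph \<Rightarrow> real"
  assumes V: "card V \<ge> 2" and A: "A \<subseteq> V" "card A = Suc k"
    and step: "\<And>w E. w \<in> A \<Longrightarrow> E \<in> set_pmf (attachment_law V k (A - {w})) \<Longrightarrow>
       (\<Sum>u\<in>V - {w}. h (attach A u w E)) \<le> real (card V - 1) * g w E"
    and bound: "\<And>w. w \<in> A \<Longrightarrow> measure_pmf.expectation (attachment_law V k (A - {w})) (g w) \<le> c"
  shows "measure_pmf.expectation (attachment_law V (Suc k) A) h \<le> c"
proof -
  let ?L = "\<lambda>w. attachment_law V k (A - {w})" and ?N = "real (card V - 1)"
  have fin: "finite V" "finite A" "A \<noteq> {}"
    using V A card_ge_0_finite[of V] card_ge_0_finite[of A] by auto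
  have finL: "finite (set_pmf (?L w))" if "w \<in> A" for w
    using that A by (intro finite_attachment_law[OF V]) (auto intro: card_remove_Suc)
  have int: "integrable (measure_pmf (?L w)) f" if "w \<in> A" for w and f :: "_ \<Rightarrow> real"
    using finL[OF that] by (rule integrable_measure_pmf_finite)
  have ne: "V - {w} \<noteq> {}" for w using Diff_singleton_nonempty[OF V] .
  have N: "?N > 0" using V by simp
  let ?M = "\<lambda>w. pmf_of_set (V - {w}) \<bind> (\<lambda>u. map_pmf (attach A u w) (?L w))"
  have finM: "finite (set_pmf (?M w))" if "w \<in> A" for w
    using finL[OF that] ne[of w] fin(1) by (auto simp: set_pmf_of_set)
  have M: "measure_pmf.expectation (?M w) h \<le> c" if w: "w \<in> A" for w
  proof -
    have cd: "card (V - {w}) = card V - 1" using w A by auto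
    have "measure_pmf.expectation (?M w) h =
       (\<Sum>u\<in>V - {w}. measure_pmf.expectation (?L w) (\<lambda>E. h (attach A u w E)) / ?N)"
      using fin ne finL[OF w]
      by (subst pmf_expectation_bind_pmf_of_set) (auto simp: cd divide_inverse mult.commute)
    also have "\<dots> = measure_pmf.expectation (?L w) (\<lambda>E. (\<Sum>u\<in>V - {w}. h (attach A u w E))) / ?N"
      using int[OF w] by (subst Bochner_Integration.integral_sum) (auto simp: sum_divide_distrib)
    also have "\<dots> \<le> measure_pmf.expectation (?L w) (\<lambda>E. ?N * g w E) / ?N"
      using N int[OF w] step[OF w]
      by (intro divide_right_mono integral_mono_AE) (auto simp: AE_measure_pmf_iff)
    also have "\<dots> = measure_pmf.expectation (?L w) (g w)" using N by simp
    also have "\<dots> \<le> c" by (rule bound[OF w])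
    finally show ?thesis .
  qed
  have "measure_pmf.expectation (attachment_law V (Suc k) A) h
      = (\<Sum>w\<in>A. measure_pmf.expectation (?M w) h) / card A"
    using fin finM unfolding attachment_law.simps
    by (subst pmf_expectation_bind_pmf_of_set) (simp_all add: divide_inverse sum_distrib_left mult.commute)
  also have "\<dots> \<le> (\<Sum>w\<in>A. c) / card A"
    by (intro divide_right_mono sum_mono M) auto
  also have "\<dots> = c" using A by simp
  finally show ?thesis .
qed

section \<open>An upper bound for the expected number of large trees\<close>

definition large_trees :: "nat \<Rightarrow> nat set set \<Rightarrow> real" where
  "large_trees x \<T> = (\<Sum>T\<in>\<T>. of_bool (x \<le> card T))"

text \<open>A supersolution of the recursion for the expected number of trees of size at least \<open>x\<close> after \<open>t\<close> vertices.
It is the discrete form of \<open>B x = N exp s (1 - exp (-s)) ^ x / x\<close> with \<open>s = t / N\<close>, which solves the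
continuous recursion exactly: the derivative of \<open>B (x + 1)\<close> in \<open>s\<close> is \<open>x (B x - B (x + 1))\<close>. The
factor \<open>exp s\<close> stays bounded on the unit interval.\<close>

definition upper_profile :: "real \<Rightarrow> nat \<Rightarrow> nat \<Rightarrow> real" where
  "upper_profile N x t = (1 + 1 / N) ^ t * N * (1 - (1 - 1 / N) ^ t) ^ x / x"

lemma power_add_ge_linear:
  fixes a b :: real
  assumes "a \<ge> 0" "b \<ge> 0"
  shows "a ^ Suc n + real (Suc n) * b * a ^ n \<le> (a + b) ^ Suc n"
proof (induction n)
  case 0
  then show ?case by simp
next
  case (Suc n)
  have "a ^ Suc (Suc n) + real (Suc (Suc n)) * b * a ^ Suc n
    \<le> a ^ Suc (Suc n) + real (Suc (Suc n)) * b * a ^ Suc n + real (Suc n) * b * b * a ^ n"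
    using assms by simp
  also have "\<dots> = (a + b) * (a ^ Suc n + real (Suc n) * b * a ^ n)"
    by (simp add: algebra_simps)
  also have "\<dots> \<le> (a + b) * (a + b) ^ Suc n"
    using assms by (intro mult_left_mono Suc) auto
  finally show ?case by simp
qed

lemma power_diff_le:
  fixes a b :: real
  assumes "0 \<le> a" "a \<le> b"
  shows "b ^ Suc n - a ^ Suc n \<le> real (Suc n) * b ^ n * (b - a)"
proof (induction n)
  case 0
  then show ?case by simp
next
  case (Suc n)
  have "b ^ Suc (Suc n) - a ^ Suc (Suc n) = b * (b ^ Suc n - a ^ Suc n) + a ^ Suc n * (b - a)"
    by (simp add: algebra_simps)
  also have "\<dots> \<le> b * (real (Suc n) * b ^ n * (b - a)) + b ^ Suc n * (b - a)"
    using assms by (intro add_mono mult_left_mono mult_right_mono Suc power_mono) auto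
  also have "\<dots> = real (Suc (Suc n)) * b ^ Suc n * (b - a)"
    by (simp add: algebra_simps)
  finally show ?case .
qed

text \<open>Put \<open>g = 1 - (1 - 1 / N) ^ t\<close>. Its increment is \<open>(1 - g) / N\<close>, and Bernoulli's inequality at \<open>g\<close> falls short of the
claim by a multiple of \<open>g ^ Suc x\<close>, which the additional factor \<open>1 + 1 / N\<close> makes up for.\<close>

lemma upper_profile_step:
  assumes N: "N \<ge> 1" and x: "x \<ge> 1"
  shows "(1 - x / N) * upper_profile N (Suc x) t + x / N * upper_profile N x t
     \<le> upper_profile N (Suc x) (Suc t)"
proof -
  define q where "q = 1 - 1 / N"
  define g where "g = 1 - q ^ t"
  define h where "h = (1 - g) / N"
  have q: "0 \<le> q" "q \<le> 1" using N by (auto simp: q_def field_simps)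
  have g: "0 \<le> g" "g \<le> 1" using q by (auto simp: g_def power_le_one)
  have h: "h \<ge> 0" using g N by (simp add: h_def)
  have gs: "1 - q ^ Suc t = g + h"
    by (simp add: h_def g_def q_def algebra_simps)
  let ?c = "(1 + 1 / N) ^ t"
  have "(N - x) * g ^ Suc x + (x + 1) * g ^ x = N * (g ^ Suc x + real (Suc x) * h * g ^ x) + g ^ Suc x"
    using N by (simp add: h_def field_simps)
  also have "\<dots> \<le> N * (g ^ Suc x + real (Suc x) * h * g ^ x) + (g ^ Suc x + real (Suc x) * h * g ^ x)"
    using g h by simp
  also have "\<dots> = (N + 1) * (g ^ Suc x + real (Suc x) * h * g ^ x)" by (simp add: algebra_simps)
  also have "\<dots> \<le> (N + 1) * (g + h) ^ Suc x"
    using N g h by (intro mult_left_mono power_add_ge_linear) auto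
  finally have *: "(N - x) * g ^ Suc x + (x + 1) * g ^ x \<le> (N + 1) * (g + h) ^ Suc x" .
  have "(1 - x / N) * upper_profile N (Suc x) t + x / N * upper_profile N x t
     = ?c / (x + 1) * ((N - x) * g ^ Suc x + (x + 1) * g ^ x)"
    using N x unfolding upper_profile_def q_def[symmetric] g_def[symmetric]
    by (simp add: divide_simps) (simp add: algebra_simps)
  also have "\<dots> \<le> ?c / (x + 1) * ((N + 1) * (g + h) ^ Suc x)"
    using N by (intro mult_left_mono *) auto
  also have "\<dots> = upper_profile N (Suc x) (Suc t)"
    using N x unfolding upper_profile_def q_def[symmetric] gs
    by (simp add: divide_simps)
  finally show ?thesis .
qed

lemma upper_profile_1:
  assumes N: "N \<ge> 1"
  shows "real t \<le> upper_profile N 1 t"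
proof (induction t)
  case 0
  then show ?case by (simp add: upper_profile_def)
next
  case (Suc t)
  define q where "q = 1 - 1 / N"
  have q: "0 \<le> q" "q \<le> 1" using N by (auto simp: q_def field_simps)
  have qt: "0 \<le> q ^ t" "q ^ t \<le> 1" using q by (auto simp: power_le_one)
  let ?c = "(1 + 1 / N) ^ t"
  have c: "?c \<ge> 1" using N by (intro one_le_power) auto
  have "?c * 1 \<le> ?c * (1 + q ^ t / N)"
    using c N qt by (intro mult_left_mono) auto
  also have "\<dots> = upper_profile N 1 (Suc t) - upper_profile N 1 t"
    using N unfolding upper_profile_def q_def[symmetric] power_Suc
    unfolding q_def by (simp add: field_simps)
  finally show ?case using Suc c by simp
qed

lemma large_trees_attach:
  assumes "finite \<T>" "T \<in> \<T>" "finite T" "\<And>T'. T' \<in> \<T> \<Longrightarrow> w \<notin> T'"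
  shows "large_trees (Suc x) (insert (insert w T) (\<T> - {T}))
     = large_trees (Suc x) \<T> + of_bool (card T = x)"
proof -
  have "insert w T \<notin> \<T> - {T}" "w \<notin> T" using assms by auto
  then show ?thesis
    using assms sum.remove[OF assms(1,2), of "\<lambda>T. of_bool (Suc x \<le> card T) :: real"]
    by (auto simp: large_trees_def of_bool_def)
qed

lemma attachment_law_edges:
  assumes "card V \<ge> 2" "A \<subseteq> V" "card A = Suc k" "w \<in> A"
    "E \<in> set_pmf (attachment_law V k (A - {w}))"
  shows "E \<subseteq> (A - {w}) \<times> (A - {w})"
  using attachment_law_support[OF assms(1) _ _ assms(5)] assms(2-4) by (auto simp: card_remove_Suc)

text \<open>The number of trees of size at least \<open>y + 1\<close> grows by one exactly when the new vertex joins a tree of size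
\<open>y\<close>, which has probability \<open>y / N\<close> times the number of these trees. The expectations therefore satisfy a
linear recursion, of which \<open>upper_profile\<close> is a supersolution.\<close>

lemma expected_large_trees:
  assumes V: "card V \<ge> 2" and "A \<subseteq> V" "card A = k" "1 \<le> x" "x \<le> card V"
  shows "measure_pmf.expectation (attachment_law V k A) (\<lambda>E. large_trees x (component E ` A))
     \<le> upper_profile (card V - 1) x k"
  using assms(2-)
proof (induction k arbitrary: A x)
  case 0
  have "finite A"
    using V 0 card_ge_0_finite[of V] by (auto intro: finite_subset)
  then have "A = {}" using 0 by simp
  then show ?case using 0 by (simp add: large_trees_def upper_profile_def)
next
  case (Suc k)
  define N where "N = card V - 1"
  have N: "N \<ge> 1" using V by (simp add: N_def)
  have finV: "finite V" using V card_ge_0_finite[of V] by simp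
  have fin: "finite A" using finV Suc.prems by (auto intro: finite_subset)
  show ?case
  proof (cases "x = 1")
    case True
    have "large_trees x (component E ` A) \<le> Suc k" for E
    proof -
      have "large_trees x (component E ` A) \<le> (\<Sum>T\<in>component E ` A. 1)"
        unfolding large_trees_def by (intro sum_mono) auto
      also have "\<dots> \<le> card A" using card_image_le[OF fin, of "component E"] by simp
      finally show ?thesis using Suc.prems by simp
    qed
    then have "measure_pmf.expectation (attachment_law V (Suc k) A) (\<lambda>E. large_trees x (component E ` A))
       \<le> measure_pmf.expectation (attachment_law V (Suc k) A) (\<lambda>E. Suc k)"
      using Suc.prems by (intro integral_mono integrable_measure_pmf_finite finite_attachment_law[OF V]) auto
    also have "\<dots> = real (Suc k)" by simp
    also have "\<dots> \<le> upper_profile N x (Suc k)" using upper_profile_1[of N "Suc k"] N True by simp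
    finally show ?thesis by (simp add: N_def)
  next
    case False
    then obtain y where y: "x = Suc y" "1 \<le> y" "y \<le> N"
      using Suc.prems by (cases x) (auto simp: N_def)
    define g where "g = (\<lambda>w E. (1 - real y / N) * large_trees (Suc y) (component E ` (A - {w}))
        + real y / N * large_trees y (component E ` (A - {w})))"
    have "measure_pmf.expectation (attachment_law V (Suc k) A) (\<lambda>E. large_trees (Suc y) (component E ` A))
       \<le> upper_profile N (Suc y) (Suc k)"
    proof (rule expectation_attachment_le[OF V Suc.prems(1,2), where g = g])
      fix w E assume w: "w \<in> A" and E0: "E \<in> set_pmf (attachment_law V k (A - {w}))"
      let ?A = "A - {w}" and ?T = "component E ` (A - {w})"
      have A: "A = insert w ?A" using w by auto
      have E: "E \<subseteq> ?A \<times> ?A" using attachment_law_edges[OF V Suc.prems(1,2) w E0] .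
      have T: "finite T" "w \<notin> T" if "T \<in> ?T" for T
        using that components_partition(1)[OF E] fin by (auto dest: finite_subset[rotated])
      have cA: "card ?A = k" using Suc.prems w by (intro card_remove_Suc)
      have sumT: "(\<Sum>T\<in>?T. real (card T)) = k"
        using sum_over_components[OF E, of "\<lambda>_. 1 :: real" "\<lambda>_. 1"] fin cA by simp
      have diff: "(\<Sum>T\<in>?T. real (card T) * of_bool (card T = y))
         = y * (large_trees y ?T - large_trees (Suc y) ?T)"
        unfolding large_trees_def sum_subtractf[symmetric] sum_distrib_left
        by (intro sum.cong refl) auto
      have "(\<Sum>u\<in>V - {w}. large_trees (Suc y) (component (attach A u w E) ` A))
        = (\<Sum>T\<in>?T. card T * large_trees (Suc y) (insert (insert w T) (?T - {T})))
          + (real N - k) * large_trees (Suc y) (insert {w} ?T)"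
        using sum_attach[OF finV, of ?A w E "large_trees (Suc y)"] Suc.prems w E A cA
        by (simp add: N_def subset_iff)
      also have "large_trees (Suc y) (insert {w} ?T) = large_trees (Suc y) ?T"
      proof -
        have "{w} \<notin> ?T" using T by auto
        then show ?thesis using fin y by (simp add: large_trees_def)
      qed
      also have "(\<Sum>T\<in>?T. card T * large_trees (Suc y) (insert (insert w T) (?T - {T})))
         = (\<Sum>T\<in>?T. real (card T) * large_trees (Suc y) ?T + real (card T) * of_bool (card T = y))"
      proof (intro sum.cong refl)
        fix T assume "T \<in> ?T"
        then have "large_trees (Suc y) (insert (insert w T) (?T - {T}))
          = large_trees (Suc y) ?T + of_bool (card T = y)"
          using fin T by (intro large_trees_attach) (blast | simp)+
        then show "card T * large_trees (Suc y) (insert (insert w T) (?T - {T}))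
          = real (card T) * large_trees (Suc y) ?T + real (card T) * of_bool (card T = y)"
          by (simp only: distrib_left)
      qed
      also have "\<dots> = k * large_trees (Suc y) ?T + y * (large_trees y ?T - large_trees (Suc y) ?T)"
        by (simp only: sum.distrib sum_distrib_right[symmetric] sumT diff)
      also have "k * large_trees (Suc y) ?T + y * (large_trees y ?T - large_trees (Suc y) ?T)
          + (real N - k) * large_trees (Suc y) ?T = real N * g w E"
        using N by (simp add: g_def field_simps)
      finally show "(\<Sum>u\<in>V - {w}. large_trees (Suc y) (component (attach A u w E) ` A)) \<le> real (card V - 1) * g w E"
        by (simp add: N_def)
    next
      fix w assume w: "w \<in> A"
      let ?L = "attachment_law V k (A - {w})"
      have cA: "card (A - {w}) = k" using Suc.prems w by (intro card_remove_Suc)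
      have int: "integrable (measure_pmf ?L) f" for f :: "_ \<Rightarrow> real"
        using Suc.prems cA
        by (intro integrable_measure_pmf_finite finite_attachment_law[OF V]) auto
      have "measure_pmf.expectation ?L (g w)
        = (1 - real y / N) * measure_pmf.expectation ?L (\<lambda>E. large_trees (Suc y) (component E ` (A - {w})))
        + real y / N * measure_pmf.expectation ?L (\<lambda>E. large_trees y (component E ` (A - {w})))"
        unfolding g_def using int by (simp add: Bochner_Integration.integral_add)
      also have "\<dots> \<le> (1 - real y / N) * upper_profile N (Suc y) k + real y / N * upper_profile N y k"
        unfolding N_def using Suc.prems y N cA
        by (intro add_mono mult_left_mono Suc.IH) (auto simp: N_def)
      also have "\<dots> \<le> upper_profile N (Suc y) (Suc k)"
        using upper_profile_step[of N y k] N y by simp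
      finally show "measure_pmf.expectation ?L (g w) \<le> upper_profile N (Suc y) (Suc k)" .
    qed
    then show ?thesis by (simp add: y N_def)
  qed
qed

section \<open>The growth of a single tree\<close>

text \<open>The probability that a pure birth chain, which jumps from \<open>s\<close> to \<open>s + 1\<close> with probability \<open>p s\<close>, is at
\<open>x\<close> or above after \<open>r\<close> steps from \<open>s\<close>.\<close>

primrec reach :: "(nat \<Rightarrow> real) \<Rightarrow> nat \<Rightarrow> nat \<Rightarrow> nat \<Rightarrow> real" where
  "reach p x s 0 = of_bool (x \<le> s)"
| "reach p x s (Suc r) = (1 - p s) * reach p x s r + p s * reach p x (Suc s) r"

lemma reach_bounds:
  assumes "\<And>s. p s \<in> {0..1}"
  shows "reach p x s r \<in> {0..1}"
proof (induction r arbitrary: s)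
  case 0
  then show ?case by simp
next
  case (Suc r)
  show ?case
    using Suc[of s] Suc[of "Suc s"] assms[of s]
      convex_bound_le[of "reach p x s r" 1 "reach p x (Suc s) r" "1 - p s" "p s"]
    by simp
qed

lemma reach_mono:
  assumes "\<And>s. p s \<in> {0..1}"
  shows "reach p x s r \<le> reach p x (Suc s) r"
proof (induction r arbitrary: s)
  case 0
  then show ?case by simp
next
  case (Suc r)
  have "reach p x s (Suc r) \<le> (1 - p s) * reach p x (Suc s) r + p s * reach p x (Suc s) r"
    unfolding reach.simps using Suc[of s] assms[of s] by (intro add_mono mult_left_mono) auto
  also have "\<dots> = (1 - p (Suc s)) * reach p x (Suc s) r + p (Suc s) * reach p x (Suc s) r"
    by (simp add: algebra_simps)
  also have "\<dots> \<le> reach p x (Suc s) (Suc r)"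
    unfolding reach.simps using Suc[of "Suc s"] assms[of "Suc s"] by (intro add_mono mult_left_mono) auto
  finally show ?case .
qed

text \<open>The definition conditions on the first step, this equation on the last one. The survival estimate needs the
former, because it looks at a tree of arbitrary current size, and the lower bound the latter, because it
starts from size one.\<close>

lemma reach_forward:
  "reach p (Suc x) s (Suc r) = (1 - p x) * reach p (Suc x) s r + p x * reach p x s r"
proof (induction r arbitrary: s)
  case 0
  show ?case by (cases "s = x") (auto simp: of_bool_def le_Suc_eq)
next
  case (Suc r)
  have "reach p (Suc x) s (Suc (Suc r))
    = (1 - p s) * reach p (Suc x) s (Suc r) + p s * reach p (Suc x) (Suc s) (Suc r)"
    by simp
  also have "\<dots> = (1 - p s) * ((1 - p x) * reach p (Suc x) s r + p x * reach p x s r)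
     + p s * ((1 - p x) * reach p (Suc x) (Suc s) r + p x * reach p x (Suc s) r)"
    by (simp only: Suc)
  also have "\<dots> = (1 - p x) * reach p (Suc x) s (Suc r) + p x * reach p x s (Suc r)"
    by (simp add: algebra_simps)
  finally show ?case .
qed

lemma reach_already:
  "x \<le> s \<Longrightarrow> reach p x s r = 1"
  by (induction r arbitrary: s) auto

text \<open>In continuous time the size would be geometric and the probability would be \<open>(1 - exp (- t / N)) ^ x\<close>. In discrete
time at least \<open>x\<close> steps are needed for \<open>x\<close> jumps, so no bound of this form can hold from time zero; delaying the
clock by one step per level repairs this, and convexity of the power then gives the induction step.\<close>

lemma reach_lower_bound:
  assumes N: "N \<ge> 1" and p: "\<And>s. p s = min 1 (real s / N)" and x: "x \<le> N"
  shows "(1 - (1 - 1 / N) ^ (t - x)) ^ x \<le> reach p (Suc x) 1 t"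
  using x
proof (induction t arbitrary: x)
  case 0
  then show ?case by (cases x) auto
next
  case (Suc t)
  define q where "q = 1 - 1 / N"
  have q: "0 \<le> q" "q \<le> 1" using N by (auto simp: q_def field_simps)
  have p01: "p s \<in> {0..1}" for s using N by (auto simp: p)
  show ?case
  proof (cases x)
    case 0
    then show ?thesis using reach_already[of 1 1 p "Suc t"] by simp
  next
    case (Suc y)
    show ?thesis
    proof (cases "x \<le> t")
      case False
      then have "Suc t - x = 0" by simp
      then show ?thesis using Suc reach_bounds[of p "Suc x" 1 "Suc t", OF p01] by simp
    next
      case True
      define a where "a = 1 - q ^ (t - x)"
      define b where "b = 1 - q ^ (t - y)"
      have ab: "b = a + (1 - a) / N"
      proof -
        have "t - y = Suc (t - x)" using True Suc by simp
        then show ?thesis by (simp add: a_def b_def q_def algebra_simps)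
      qed
      have ba: "b - a = (1 - a) / N" using ab by simp
      have a: "0 \<le> a" "a \<le> 1" using q by (auto simp: a_def power_le_one)
      have le: "a \<le> b" using a N by (simp add: ab)
      have px: "p x = x / N" using Suc.prems N by (simp add: p)
      \<comment> \<open>because of the delay the lower level is evaluated one step later, at \<open>b\<close> instead of \<open>a\<close>; this is what convexity requires\<close>
      have "b ^ x - a ^ x \<le> real x * b ^ y * (b - a)"
        using power_diff_le[OF a(1) le, of y] Suc by simp
      also have "\<dots> = x / N * (b ^ y - a * b ^ y)"
        using N by (simp only: ba) (simp add: field_simps)
      also have "\<dots> \<le> x / N * (b ^ y - a * a ^ y)"
        using a le N by (intro mult_left_mono diff_left_mono power_mono) auto
      also have "a * a ^ y = a ^ x" using Suc by simp
      finally have "b ^ x \<le> (1 - p x) * a ^ x + p x * b ^ y"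
        by (simp add: px algebra_simps)
      also have "\<dots> \<le> (1 - p x) * reach p (Suc x) 1 t + p x * reach p x 1 t"
        using Suc.IH[of x] Suc.IH[of y] Suc.prems p01[of x] Suc
        by (intro add_mono mult_left_mono) (auto simp: a_def b_def q_def)
      also have "\<dots> = reach p (Suc x) 1 (Suc t)" by (rule reach_forward[symmetric])
      finally show ?thesis using Suc by (simp add: b_def q_def)
    qed
  qed
qed

section \<open>The probability that all trees stay small\<close>

text \<open>The probability that all trees of the partition stay below size \<open>x\<close> for \<open>r\<close> more steps, if the trees grew
independently and no new ones were born.\<close>

definition survival :: "(nat \<Rightarrow> real) \<Rightarrow> nat \<Rightarrow> nat \<Rightarrow> nat set set \<Rightarrow> real" where
  "survival p x r \<T> = (\<Prod>T\<in>\<T>. 1 - reach p x (card T) r)"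

text \<open>Trees compete for the new vertex, so their growth is negatively correlated: at most one grows in a step, and
the probability \<open>1 - (\<Sum>a + b)\<close> that none of the dangerous events happens is at most the product of the
complementary probabilities. This is Weierstrass' product inequality. The birth of a new tree is one more of
these exclusive events.\<close>

lemma survival_step:
  fixes \<T> :: "nat set set"
  assumes fin: "finite \<T>" and p: "\<And>s. p s \<in> {0..1}" and N: "N > 0"
    and pc: "\<And>T. T \<in> \<T> \<Longrightarrow> p (card T) = card T / N"
    and k: "(\<Sum>T\<in>\<T>. real (card T)) = k" "k \<le> N"
    and w: "\<And>T. T \<in> \<T> \<Longrightarrow> w \<notin> T \<and> finite T"
  shows "(\<Sum>T\<in>\<T>. card T * survival p x r (insert (insert w T) (\<T> - {T})))
     + (N - k) * survival p x r (insert {w} \<T>)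
    \<le> N * ((1 - (1 - k / N) * reach p x 1 r) * survival p x (Suc r) \<T>)"
proof -
  define u where "u T = 1 - reach p x (card T) r" for T :: "nat set"
  define u' where "u' T = 1 - reach p x (Suc (card T)) r" for T :: "nat set"
  \<comment> \<open>the conditional risk of tree \<open>T\<close> in this step; if \<open>u T = 0\<close>, all products that contain it vanish\<close>
  define a where "a T = p (card T) * (1 - u' T / u T)" for T
  define b where "b = (1 - k / N) * reach p x 1 r"
  define Q where "Q = (\<Prod>T\<in>\<T>. u T)"
  have u: "0 \<le> u' T" "u' T \<le> u T" "u T \<le> 1" for T
    using reach_bounds[of p x _ r, OF p] reach_mono[of p x "card T" r, OF p] by (auto simp: u_def u'_def)
  have a: "a T \<in> {0..1}" for T
  proof -
    have "u' T / u T \<in> {0..1}" using u[of T] by (cases "u T = 0") (auto simp: field_simps)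
    then show ?thesis using p[of "card T"] by (auto simp: a_def intro!: mult_le_one)
  qed
  have k0: "0 \<le> k" using k(1) by (metis of_nat_0_le_iff sum_nonneg)
  have b: "0 \<le> b" using reach_bounds[of p x 1 r, OF p] k N by (auto simp: b_def)
  have Q: "Q \<ge> 0" unfolding Q_def using u by (intro prod_nonneg) (meson order_trans)
  have ua: "u T * (1 - a T) = 1 - reach p x (card T) (Suc r)" for T
  proof (cases "u T = 0")
    case True
    then have "u' T = 0" using u[of T] by simp
    then show ?thesis using True by (simp add: u_def u'_def)
  next
    case False
    then have "u T * (1 - a T) = u T - p (card T) * (u T - u' T)"
      by (simp add: a_def field_simps)
    then show ?thesis by (simp add: u_def u'_def algebra_simps)
  qed
  have child: "card T * survival p x r (insert (insert w T) (\<T> - {T})) = N * (Q * (card T / N - a T))"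
    if T: "T \<in> \<T>" for T
  proof -
    have "insert w T \<notin> \<T> - {T}" "w \<notin> T" "finite T" using w T by auto
    then have 1: "survival p x r (insert (insert w T) (\<T> - {T})) = u' T * (\<Prod>T\<in>\<T> - {T}. u T)"
      using fin by (simp add: survival_def u_def u'_def)
    have 2: "Q = u T * (\<Prod>T\<in>\<T> - {T}. u T)"
      unfolding Q_def by (rule prod.remove[OF fin T])
    show ?thesis
    proof (cases "u T = 0")
      case True
      then have "u' T = 0" using u[of T] by simp
      then show ?thesis using True by (simp add: 1 2)
    next
      case False
      then show ?thesis using N by (simp add: 1 2 a_def pc[OF T] field_simps)
    qed
  qed
  have root: "survival p x r (insert {w} \<T>) = (1 - reach p x 1 r) * Q"
  proof -
    have "{w} \<notin> \<T>" using w by auto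
    then show ?thesis using fin by (simp add: survival_def Q_def u_def)
  qed
  have "(\<Sum>T\<in>\<T>. card T * survival p x r (insert (insert w T) (\<T> - {T})))
     = N * (Q * (k / N - (\<Sum>T\<in>\<T>. a T)))"
    using child by (simp add: sum_distrib_left[symmetric] sum_subtractf sum_divide_distrib[symmetric] k(1))
  then have "(\<Sum>T\<in>\<T>. card T * survival p x r (insert (insert w T) (\<T> - {T})))
     + (N - k) * survival p x r (insert {w} \<T>) = N * (Q * (1 - (\<Sum>T\<in>\<T>. a T) - b))"
    using N by (simp add: root b_def field_simps)
  also have "1 - (\<Sum>T\<in>\<T>. a T) - b \<le> (1 - b) * (\<Prod>T\<in>\<T>. 1 - a T)"
  proof -
    let ?P = "\<Prod>T\<in>\<T>. 1 - a T"
    have "1 - (\<Sum>T\<in>\<T>. a T) \<le> ?P" using a by (intro Weierstrass_prod_ineq)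
    moreover have "?P \<le> 1" using a by (intro prod_le_1) auto
    then have "b * ?P \<le> b" using b by (simp add: mult_left_le)
    ultimately show ?thesis by (simp add: algebra_simps)
  qed
  also have "Q * ((1 - b) * (\<Prod>T\<in>\<T>. 1 - a T)) = (1 - b) * survival p x (Suc r) \<T>"
    unfolding Q_def survival_def ua[symmetric] prod.distrib by simp
  finally show ?thesis using N Q by (simp add: b_def mult_left_mono)
qed

text \<open>Iterating the step gives one factor for each vertex: vertex number \<open>s\<close> founds a tree with probability
\<open>1 - s / N\<close>, and this tree has all the remaining time to reach size \<open>x\<close>.\<close>

lemma expected_survival:
  assumes V: "card V \<ge> 2" and "A \<subseteq> V" "card A = k"
    and N: "N = real (card V - 1)" and p: "\<And>s. p s = min 1 (real s / N)"
  shows "measure_pmf.expectation (attachment_law V k A) (\<lambda>E. survival p x r (component E ` A))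
     \<le> (\<Prod>s<k. 1 - (1 - s / N) * reach p x 1 (r + (k - Suc s)))"
  using assms(2,3)
proof (induction k arbitrary: A r)
  case 0
  have "finite A"
    using V 0 card_ge_0_finite[of V] by (auto intro: finite_subset)
  then have "A = {}" using 0 by simp
  then show ?case by (simp add: survival_def)
next
  case (Suc k)
  have N0: "N \<ge> 1" using V by (simp add: N)
  have p01: "p s \<in> {0..1}" for s using N0 by (auto simp: p)
  have finV: "finite V" using V card_ge_0_finite[of V] by simp
  have fin: "finite A" using finV Suc.prems by (auto intro: finite_subset)
  have kN: "real k \<le> N" using card_mono[OF finV Suc.prems(1)] Suc.prems by (simp add: N)
  define c where "c = 1 - (1 - k / N) * reach p x 1 r"
  have c: "c \<ge> 0"
    using reach_bounds[of p x 1 r, OF p01] kN N0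
    unfolding c_def by (auto intro!: mult_le_one)
  show ?case
  proof (rule expectation_attachment_le[OF V Suc.prems,
        where g = "\<lambda>w E. c * survival p x (Suc r) (component E ` (A - {w}))"])
    fix w E assume w: "w \<in> A" and E0: "E \<in> set_pmf (attachment_law V k (A - {w}))"
    let ?A = "A - {w}" and ?T = "component E ` (A - {w})"
    have A: "A = insert w ?A" using w by auto
    have E: "E \<subseteq> ?A \<times> ?A" using attachment_law_edges[OF V Suc.prems w E0] .
    have cA: "card ?A = k" using Suc.prems w by (intro card_remove_Suc)
    have T: "w \<notin> T \<and> finite T" "T \<subseteq> ?A" if "T \<in> ?T" for T
      using that components_partition(1)[OF E] fin by (auto dest: finite_subset[rotated])
    have pc: "p (card T) = card T / N" if "T \<in> ?T" for T
    proof -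
      have "card T \<le> k" using T(2)[OF that] fin cA card_mono[of ?A T] by simp
      then show ?thesis using kN N0 by (simp add: p)
    qed
    have sumT: "(\<Sum>T\<in>?T. real (card T)) = k"
      using sum_over_components[OF E, of "\<lambda>_. 1 :: real" "\<lambda>_. 1"] fin cA by simp
    have "(\<Sum>u\<in>V - {w}. survival p x r (component (attach A u w E) ` A))
        = (\<Sum>T\<in>?T. card T * survival p x r (insert (insert w T) (?T - {T})))
          + (N - k) * survival p x r (insert {w} ?T)"
      using sum_attach[OF finV, of ?A w E "survival p x r"] Suc.prems w E A cA
      by (simp add: N subset_iff)
    also have "\<dots> \<le> N * (c * survival p x (Suc r) ?T)"
      unfolding c_def
    proof (rule survival_step[OF _ p01 _ pc sumT kN T(1)])
      show "finite ?T" "N > 0" using fin N0 by auto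
    qed
    finally show "(\<Sum>u\<in>V - {w}. survival p x r (component (attach A u w E) ` A))
       \<le> real (card V - 1) * (c * survival p x (Suc r) ?T)" by (simp add: N)
  next
    fix w assume w: "w \<in> A"
    let ?L = "attachment_law V k (A - {w})"
    have cA: "card (A - {w}) = k" using Suc.prems w by (intro card_remove_Suc)
    have "measure_pmf.expectation ?L (\<lambda>E. c * survival p x (Suc r) (component E ` (A - {w})))
      = c * measure_pmf.expectation ?L (\<lambda>E. survival p x (Suc r) (component E ` (A - {w})))" by simp
    also have "\<dots> \<le> c * (\<Prod>s<k. 1 - (1 - s / N) * reach p x 1 (Suc r + (k - Suc s)))"
      using Suc.prems cA by (intro mult_left_mono c Suc.IH) auto
    also have "\<dots> = (\<Prod>s<Suc k. 1 - (1 - s / N) * reach p x 1 (r + (Suc k - Suc s)))"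
    proof -
      have "Suc r + (k - Suc s) = r + (Suc k - Suc s)" if "s < k" for s using that by simp
      then have "(\<Prod>s<k. 1 - (1 - s / N) * reach p x 1 (Suc r + (k - Suc s)))
         = (\<Prod>s<k. 1 - (1 - s / N) * reach p x 1 (r + (Suc k - Suc s)))"
        by (intro prod.cong refl) (simp only: lessThan_iff)
      then show ?thesis by (simp only: prod.lessThan_Suc c_def diff_self_eq_0 add_0_right mult.commute)
    qed
    finally show "measure_pmf.expectation ?L (\<lambda>E. c * survival p x (Suc r) (component E ` (A - {w})))
      \<le> (\<Prod>s<Suc k. 1 - (1 - s / N) * reach p x 1 (r + (Suc k - Suc s)))" .
  qed
qed

section \<open>Tail bounds for the largest tree\<close>

lemma max_tree_size_ge_iff:
  assumes "n \<ge> 1"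
  shows "m \<le> max_tree_size n F \<longleftrightarrow> (\<exists>T\<in>component F ` {1..n}. m \<le> card T)"
  unfolding max_tree_size_def trees_def using assms by (subst Max_ge_iff) auto

lemma prob_max_tree_size_ge:
  assumes n: "n \<ge> 2" and m: "1 \<le> m" "m \<le> n"
  shows "measure_pmf.prob (moran_forest n) {F. m \<le> max_tree_size n F} \<le> upper_profile (real n - 1) m n"
proof -
  let ?M = "moran_forest n" and ?S = "{F. m \<le> max_tree_size n F}"
  have fin: "finite (set_pmf ?M)"
    unfolding moran_forest_eq[OF n] using n by (intro finite_attachment_law) auto
  have "measure_pmf.prob ?M ?S = measure_pmf.expectation ?M (indicator ?S)" by simp
  also have "\<dots> \<le> measure_pmf.expectation ?M (\<lambda>F. large_trees m (component F ` {1..n}))"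
  proof (rule integral_mono)
    fix F
    show "indicator ?S F \<le> large_trees m (component F ` {1..n})"
    proof (cases "F \<in> ?S")
      case True
      then obtain T where T: "T \<in> component F ` {1..n}" "m \<le> card T"
        using max_tree_size_ge_iff[of n m F] n by auto
      have "of_bool (m \<le> card T) \<le> large_trees m (component F ` {1..n})"
        unfolding large_trees_def using T(1) by (intro member_le_sum) auto
      then show ?thesis using T(2) True by simp
    qed (simp add: large_trees_def sum_nonneg)
  qed (use fin in \<open>auto intro: integrable_measure_pmf_finite\<close>)
  also have "\<dots> \<le> upper_profile (real n - 1) m n"
    using expected_large_trees[of "{1..n}" "{1..n}" n m] n m by (simp add: moran_forest_eq of_nat_diff)
  finally show ?thesis .
qed

text \<open>Only the first \<open>K\<close> vertices are used. For small \<open>K\<close> they have nearly all the time to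
grow, and almost all of them are roots.\<close>

lemma prob_max_tree_size_le:
  assumes n: "n \<ge> 2" and x: "x \<le> n - 1" and K: "K \<le> n - 1"
  defines "N \<equiv> real n - 1"
  shows "measure_pmf.prob (moran_forest n) {F. max_tree_size n F \<le> x}
     \<le> exp (- (K * (1 - K / N) * (1 - (1 - 1 / N) ^ (n - K - x)) ^ x))"
proof -
  let ?M = "moran_forest n" and ?S = "{F. max_tree_size n F \<le> x}"
  define p where "p s = min 1 (real s / N)" for s
  define q where "q = 1 - 1 / N"
  define b where "b s = (1 - s / N) * reach p (Suc x) 1 (n - Suc s)" for s
  have N: "N \<ge> 1" using n by (simp add: N_def)
  have q: "0 \<le> q" "q \<le> 1" using N by (auto simp: q_def field_simps)
  have p01: "p s \<in> {0..1}" for s using N by (auto simp: p_def)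
  have fin: "finite (set_pmf ?M)"
    unfolding moran_forest_eq[OF n] using n by (intro finite_attachment_law) auto
  \<comment> \<open>with no time left, survival is the indicator of having no tree above size \<open>x\<close>\<close>
  have surv: "survival p (Suc x) 0 (component F ` {1..n}) = indicator ?S F" for F
  proof (cases "F \<in> ?S")
    case True
    then have "\<not> Suc x \<le> max_tree_size n F" by simp
    then have "\<not> Suc x \<le> card T" if "T \<in> component F ` {1..n}" for T
      using that n max_tree_size_ge_iff[of n "Suc x" F] by auto
    then show ?thesis using True by (auto simp: survival_def intro!: prod.neutral)
  next
    case False
    then have "Suc x \<le> max_tree_size n F" by simp
    then obtain T where "T \<in> component F ` {1..n}" "Suc x \<le> card T"
      using n max_tree_size_ge_iff[of n "Suc x" F] by auto
    then have "survival p (Suc x) 0 (component F ` {1..n}) = 0"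
      unfolding survival_def by (intro prod_zero) (auto intro!: bexI[of _ T])
    then show ?thesis using False by simp
  qed
  have "measure_pmf.prob ?M ?S = measure_pmf.expectation ?M (indicator ?S)" by simp
  also have "\<dots> = measure_pmf.expectation ?M (\<lambda>F. survival p (Suc x) 0 (component F ` {1..n}))"
    by (simp only: surv)
  also have "\<dots> \<le> (\<Prod>s<n. 1 - b s)"
    using expected_survival[of "{1..n}" "{1..n}" n N p "Suc x" 0] n
    by (simp add: moran_forest_eq of_nat_diff N_def p_def b_def)
  also have "\<dots> \<le> (\<Prod>s<n. exp (- b s))"
  proof (intro prod_mono conjI)
    fix s assume "s \<in> {..<n}"
    then have "1 - s / N \<in> {0..1}" using N by (auto simp: N_def field_simps)
    then have "b s \<le> 1"
      using reach_bounds[of p "Suc x" 1 "n - Suc s", OF p01] unfolding b_def by (auto intro!: mult_le_one)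
    then show "0 \<le> 1 - b s" by simp
    show "1 - b s \<le> exp (- b s)" using exp_ge_add_one_self[of "- b s"] by simp
  qed
  also have "\<dots> = exp (- (\<Sum>s<n. b s))" by (simp add: exp_sum sum_negf[symmetric])
  also have "\<dots> \<le> exp (- (K * (1 - K / N) * (1 - q ^ (n - K - x)) ^ x))"
  proof -
    have "K * (1 - K / N) * (1 - q ^ (n - K - x)) ^ x
      = (\<Sum>s<K. (1 - K / N) * (1 - q ^ (n - K - x)) ^ x)" by simp
    also have "\<dots> \<le> (\<Sum>s<K. b s)"
    proof (rule sum_mono)
      fix s assume "s \<in> {..<K}"
      then have s: "s < K" by simp
      have "(1 - q ^ (n - K - x)) ^ x \<le> (1 - q ^ (n - Suc s - x)) ^ x"
        using q s by (intro power_mono diff_left_mono power_decreasing) (auto simp: power_le_one)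
      also have "\<dots> \<le> reach p (Suc x) 1 (n - Suc s)"
        unfolding q_def using N x by (intro reach_lower_bound[OF N p_def]) (simp add: N_def)
      finally show "(1 - K / N) * (1 - q ^ (n - K - x)) ^ x \<le> b s"
        unfolding b_def using s N K q
        by (intro mult_mono) (auto simp: divide_right_mono N_def power_le_one)
    qed
    also have "\<dots> \<le> (\<Sum>s<n. b s)"
    proof (rule sum_mono2)
      show "{..<K} \<subseteq> {..<n}" using K by auto
      show "0 \<le> b s" if "s \<in> {..<n} - {..<K}" for s
      proof -
        have "1 - s / N \<ge> 0" using that N by (auto simp: N_def field_simps)
        then show ?thesis
          using reach_bounds[of p "Suc x" 1 "n - Suc s", OF p01] unfolding b_def by simp
      qed
    qed simp
    finally show ?thesis by simp
  qed
  finally show ?thesis by (simp add: q_def)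
qed

section \<open>The threshold for the size\<close>

text \<open>A Yule process of rate one, started with one individual, has size at least \<open>m + 1\<close> at time one with
probability \<open>beta ^ m\<close>. The oldest trees of the forest live for one unit of time, so this base governs the
exponential tail of the tree sizes.\<close>

definition beta :: real where "beta = 1 - exp (- 1)"

lemma beta_bounds: "0 < beta" "beta < 1"
  by (auto simp: beta_def)

lemma exp_1_gt_2: "exp (1 :: real) > 2"
  using exp_lower_Taylor_quadratic[of "1 :: real"] by simp

lemma ln_beta: "ln beta = - 1 / moran_alpha" and alpha_pos: "moran_alpha > 0"
proof -
  have "beta = (exp 1 - 1) / exp 1" by (simp add: beta_def exp_minus field_simps)
  then have "ln beta = ln ((exp 1 - 1) / exp 1)" by (rule arg_cong)
  also have "\<dots> = ln (exp 1 - 1) - ln (exp 1)"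
    using exp_1_gt_2 by (intro ln_divide_pos) auto
  finally have *: "ln beta = ln (exp 1 - 1) - 1" by simp
  then show "ln beta = - 1 / moran_alpha" by (simp add: moran_alpha_def inverse_eq_divide)
  show "moran_alpha > 0"
    using * beta_bounds ln_less_zero[of beta] by (simp add: moran_alpha_def)
qed

text \<open>Since \<open>beta\<close> to this power equals \<open>(ln n) powr c / n\<close>, about \<open>(ln n) powr (c - 1)\<close> trees are expected to be
larger than \<open>threshold c n\<close>; the value \<open>c = 1\<close> is critical.\<close>

definition threshold :: "real \<Rightarrow> real \<Rightarrow> real" where
  "threshold c n = moran_alpha * (ln n - c * ln (ln n))"

lemma beta_powr_threshold: "beta powr threshold c n = exp (c * ln (ln n) - ln n)"
  using beta_bounds alpha_pos by (simp add: powr_def ln_beta threshold_def)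

lemma one_minus_power_le:
  assumes "n \<ge> 3"
  shows "1 - (1 - 1 / (real n - 1)) ^ n \<le> beta * exp (2 / (real n - 2))"
proof -
  define d where "d = real n - 2"
  have d: "d > 0" using assms by (simp add: d_def)
  \<comment> \<open>\<open>1 - 1 / (n - 1)\<close> is the inverse of \<open>1 + 1 / d\<close>, which bounds it from below by an exponential\<close>
  have "1 + 1 / d \<le> exp (1 / d)" using exp_ge_add_one_self[of "1 / d"] by simp
  then have "inverse (exp (1 / d)) \<le> inverse (1 + 1 / d)" using d by (intro le_imp_inverse_le) (auto intro: add_pos_pos)
  also have "inverse (1 + 1 / d) = 1 - 1 / (real n - 1)"
    using d by (simp add: d_def field_simps)
  finally have "exp (- (1 / d)) ^ n \<le> (1 - 1 / (real n - 1)) ^ n"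
    by (intro power_mono) (auto simp: exp_minus)
  also have "exp (- (1 / d)) ^ n = exp (- 1) * exp (- (2 / d))"
    using d by (simp add: exp_of_nat_mult[symmetric] exp_add[symmetric]) (simp add: d_def field_simps)
  finally have 1: "exp (- 1) * exp (- (2 / d)) \<le> (1 - 1 / (real n - 1)) ^ n" .
  have "exp (- 1) * (1 - 2 / d) \<le> exp (- 1) * exp (- (2 / d))"
    using exp_ge_add_one_self[of "- (2 / d)"] by simp
  then have "1 - (1 - 1 / (real n - 1)) ^ n \<le> beta + exp (- 1) * (2 / d)"
    using 1 by (simp add: beta_def algebra_simps)
  also have "\<dots> \<le> beta + beta * (2 / d)"
  proof -
    have "exp (- 1) \<le> beta" using exp_1_gt_2 by (simp add: beta_def exp_minus field_simps)
    then show ?thesis using d by (intro add_left_mono mult_right_mono) auto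
  qed
  also have "\<dots> \<le> beta * exp (2 / d)"
  proof -
    have "beta * (1 + 2 / d) \<le> beta * exp (2 / d)"
      using exp_ge_add_one_self[of "2 / d"] beta_bounds by (intro mult_left_mono) auto
    then show ?thesis by (simp add: distrib_left)
  qed
  finally show ?thesis by (simp add: d_def)
qed

lemma upper_profile_bound:
  assumes n: "n \<ge> 3" and y: "0 < y" "y \<le> real m"
  shows "upper_profile (real n - 1) m n \<le> exp 2 * n * (beta powr y * exp (2 / (real n - 2) * y)) / y"
proof -
  define g where "g = 1 - (1 - 1 / (real n - 1)) ^ n"
  let ?b = "beta * exp (2 / (real n - 2))"
  have q: "0 < 1 - 1 / (real n - 1)" "1 - 1 / (real n - 1) < 1" using n by (auto simp: field_simps)
  have g: "0 < g" "g \<le> 1" using q n by (auto simp: g_def power_less_one_iff)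
  have "(1 + 1 / (real n - 1)) ^ n \<le> exp (1 / (real n - 1)) ^ n"
    using n exp_ge_add_one_self[of "1 / (real n - 1)"] by (intro power_mono) auto
  also have "\<dots> = exp (n / (real n - 1))" by (simp add: exp_of_nat_mult[symmetric])
  also have "\<dots> \<le> exp 2" using n by (simp add: field_simps)
  finally have 1: "(1 + 1 / (real n - 1)) ^ n \<le> exp 2" .
  have "g ^ m = g powr real m" using g by (simp add: powr_realpow)
  also have "\<dots> \<le> g powr y" using g y by (intro powr_mono') auto
  also have "\<dots> \<le> ?b powr y"
    using one_minus_power_le[OF n] g y by (intro powr_mono2) (auto simp: g_def)
  also have "\<dots> = beta powr y * exp (2 / (real n - 2) * y)"
    using beta_bounds by (simp add: powr_mult powr_def[of "exp _"])
  finally have 2: "g ^ m \<le> beta powr y * exp (2 / (real n - 2) * y)" .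
  show ?thesis unfolding upper_profile_def g_def[symmetric]
    using n y g 1 2 by (intro frac_le mult_mono) auto
qed

text \<open>First moment: the expected number of trees above the threshold is of order \<open>(ln n) powr - \<delta>\<close>. The factor
\<open>1 / y\<close> in the bound, of order \<open>1 / ln n\<close>, is decisive for the coefficient of \<open>ln (ln n)\<close>.\<close>

lemma prob_above_threshold:
  assumes "\<delta> > 0"
  shows "(\<lambda>n. measure_pmf.prob (moran_forest n)
     {F. real (max_tree_size n F) > threshold (1 - \<delta>) (real n)}) \<longlonglongrightarrow> 0"
proof -
  define a where "a = moran_alpha"
  have a: "a > 0" using alpha_pos by (simp add: a_def)
  let ?y = "\<lambda>n :: nat. threshold (1 - \<delta>) (real n)"
  define B where "B = (\<lambda>n :: nat. exp 2 * n * (beta powr ?y n * exp (2 / (real n - 2) * ?y n)) / ?y n)"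
  have "eventually (\<lambda>n :: nat. 0 < ?y n) sequentially"
    unfolding threshold_def a_def[symmetric] using a by real_asymp
  moreover have "eventually (\<lambda>n :: nat. ?y n + 1 < real n) sequentially"
    unfolding threshold_def a_def[symmetric] using a by real_asymp
  ultimately have ev: "eventually (\<lambda>n. measure_pmf.prob (moran_forest n)
     {F. real (max_tree_size n F) > ?y n} \<le> B n) sequentially"
    using eventually_ge_at_top[of 3]
  proof eventually_elim
    case (elim n)
    define m where "m = nat \<lceil>?y n\<rceil>"
    have m: "?y n \<le> real m" "1 \<le> m" "m \<le> n" using elim unfolding m_def by linarith+
    have "measure_pmf.prob (moran_forest n) {F. real (max_tree_size n F) > ?y n}
      \<le> measure_pmf.prob (moran_forest n) {F. m \<le> max_tree_size n F}"
      by (intro measure_pmf.finite_measure_mono) (auto simp: m_def ceiling_le_iff nat_le_iff)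
    also have "\<dots> \<le> upper_profile (real n - 1) m n"
      using elim m by (intro prob_max_tree_size_ge) auto
    also have "\<dots> \<le> B n"
      unfolding B_def using elim m by (intro upper_profile_bound) auto
    finally show ?case .
  qed
  have "B \<longlonglongrightarrow> 0"
    unfolding B_def beta_powr_threshold
    unfolding threshold_def a_def[symmetric] using a assms by real_asymp
  then show ?thesis
    by (intro tendsto_sandwich[OF _ ev tendsto_const]) auto
qed

text \<open>The first \<open>n / ln n\<close> vertices have time \<open>1 - O (1 / ln n)\<close> to grow, which changes the probability of reaching
a size of order \<open>ln n\<close> only by a constant factor. About \<open>(ln n) powr \<delta>\<close> of them are thus expected to exceed
the threshold, and the probability that none does is exponentially small in this number.\<close>

lemma prob_below_threshold:
  assumes "\<delta> > 0"
  shows "(\<lambda>n. measure_pmf.prob (moran_forest n)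
     {F. real (max_tree_size n F) < threshold (1 + \<delta>) (real n)}) \<longlonglongrightarrow> 0"
proof -
  define a where "a = moran_alpha"
  have a: "a > 0" using alpha_pos by (simp add: a_def)
  let ?z = "\<lambda>n :: nat. threshold (1 + \<delta>) (real n)"
  let ?L = "\<lambda>n :: nat. ln (real n)"
  define e where "e = (\<lambda>n :: nat. 1 - exp (- (1 - 1 / ?L n - ?z n / (real n - 1))))"
  \<comment> \<open>up to a constant, the expected number of large trees founded by the first \<open>N / ln n\<close> vertices: how many there are, the chance to be a root, the chance to grow\<close>
  define W where "W = (\<lambda>n :: nat. ((real n - 1) / ?L n - 1) * (1 - 1 / ?L n) * e n powr ?z n)"
  have ev_e: "eventually (\<lambda>n. 0 < e n) sequentially"
    unfolding e_def threshold_def a_def[symmetric] using a by real_asymp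
  have "eventually (\<lambda>n. 0 < ?z n) sequentially"
    unfolding threshold_def a_def[symmetric] using a by real_asymp
  moreover have "eventually (\<lambda>n. ?z n + (real n - 1) / ?L n < real n - 1) sequentially"
    unfolding threshold_def a_def[symmetric] using a by real_asymp
  moreover have "eventually (\<lambda>n. 1 < ?L n \<and> ?L n < real n - 1) sequentially"
    by (intro eventually_conj; real_asymp)
  ultimately have ev: "eventually (\<lambda>n. measure_pmf.prob (moran_forest n)
     {F. real (max_tree_size n F) < ?z n} \<le> exp (- W n)) sequentially"
    using eventually_ge_at_top[of 2] ev_e
  proof eventually_elim
    case (elim n)
    define N where "N = real n - 1"
    define x where "x = nat \<lfloor>?z n\<rfloor>"
    define K where "K = nat \<lfloor>N / ?L n\<rfloor>"
    have N: "N \<ge> 1" using elim by (simp add: N_def)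
    have NL: "N / ?L n \<ge> 1" using elim by (simp add: N_def)
    have K: "real K \<le> N / ?L n" "N / ?L n - 1 \<le> real K" using NL unfolding K_def by linarith+
    have x: "real x \<le> ?z n" using elim unfolding x_def by linarith
    have xK: "real x + real K \<le> N" using x K elim by (simp add: N_def)
    define s where "s = n - K - x"
    have s: "real s \<ge> N - N / ?L n - ?z n" using x K xK by (simp add: s_def N_def)
    have "(1 - 1 / N) ^ s \<le> exp (- (1 / N)) ^ s"
      using N exp_ge_add_one_self[of "- (1 / N)"] by (intro power_mono) auto
    also have "\<dots> = exp (- (s / N))" by (simp add: exp_of_nat_mult[symmetric])
    also have "\<dots> \<le> exp (- (1 - 1 / ?L n - ?z n / N))"
    proof -
      have "(N - N / ?L n - ?z n) / N \<le> s / N" using s N by (intro divide_right_mono) auto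
      also have "(N - N / ?L n - ?z n) / N = 1 - 1 / ?L n - ?z n / N"
        using N by (simp add: field_simps)
      finally show ?thesis by simp
    qed
    finally have es: "e n \<le> 1 - (1 - 1 / N) ^ s" by (simp add: e_def N_def)
    have "e n powr ?z n \<le> e n powr real x"
      using elim x by (intro powr_mono') (auto simp: e_def)
    also have "\<dots> = e n ^ x" using elim by (simp add: powr_realpow)
    also have "\<dots> \<le> (1 - (1 - 1 / N) ^ s) ^ x" using es elim by (intro power_mono) auto
    finally have pow: "e n powr ?z n \<le> (1 - (1 - 1 / N) ^ s) ^ x" .
    have KN: "1 - 1 / ?L n \<le> 1 - K / N" using K N by (simp add: field_simps)
    have "1 - 1 / ?L n \<ge> 0" using elim by (simp add: field_simps)
    then have KN0: "0 \<le> 1 - K / N" using KN by linarith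
    have "W n \<le> K * (1 - K / N) * (1 - (1 - 1 / N) ^ s) ^ x"
      unfolding W_def N_def[symmetric] using K KN pow elim NL
      by (intro mult_mono mult_nonneg_nonneg KN0) auto
    moreover have "measure_pmf.prob (moran_forest n) {F. real (max_tree_size n F) < ?z n}
      \<le> measure_pmf.prob (moran_forest n) {F. max_tree_size n F \<le> x}"
      by (intro measure_pmf.finite_measure_mono) (auto simp: x_def le_nat_iff le_floor_iff)
    moreover have "\<dots> \<le> exp (- (K * (1 - K / N) * (1 - (1 - 1 / N) ^ s) ^ x))"
      unfolding s_def N_def using elim xK by (intro prob_max_tree_size_le) (auto simp: N_def)
    ultimately show ?case by (smt (verit) exp_le_cancel_iff)
  qed
  have "filterlim W at_top sequentially"
  proof -
    \<comment> \<open>splitting off \<open>beta powr z\<close> isolates the divergent factor; the remaining one has a positive limit\<close>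
    define V where "V = (\<lambda>n :: nat. ((real n - 1) / ?L n - 1) * (1 - 1 / ?L n) * exp ((1 + \<delta>) * ln (?L n) - ?L n))"
    have "filterlim V at_top sequentially"
      unfolding V_def using assms by real_asymp
    moreover have "((\<lambda>n. ?z n * ln (e n / beta)) \<longlongrightarrow> - (a * (exp (- 1) * inverse (1 - exp (- 1))))) sequentially"
      unfolding e_def threshold_def a_def[symmetric] beta_def using a by real_asymp
    then have "((\<lambda>n. exp (?z n * ln (e n / beta))) \<longlongrightarrow> exp (- (a * (exp (- 1) * inverse (1 - exp (- 1)))))) sequentially"
      by (rule tendsto_exp)
    ultimately have "filterlim (\<lambda>n. exp (?z n * ln (e n / beta)) * V n) at_top sequentially"
      by (intro filterlim_tendsto_pos_mult_at_top) auto
    moreover have "eventually (\<lambda>n. exp (?z n * ln (e n / beta)) * V n = W n) sequentially"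
      using ev_e
    proof eventually_elim
      case (elim n)
      have "e n powr ?z n = exp (?z n * ln (e n / beta)) * beta powr ?z n"
        using elim beta_bounds by (simp add: powr_def exp_add[symmetric] ln_div algebra_simps)
      then show ?case by (simp add: W_def V_def beta_powr_threshold)
    qed
    ultimately show ?thesis by (simp cong: filterlim_cong)
  qed
  then have "(\<lambda>n. exp (- W n)) \<longlonglongrightarrow> 0"
    by (intro filterlim_compose[OF exp_at_bot] filterlim_compose[OF filterlim_uminus_at_bot_at_top])
  then show ?thesis
    by (intro tendsto_sandwich[OF _ ev tendsto_const]) auto
qed

text \<open>The error term is obtained by solving for it, which requires \<open>n \<noteq> exp 1\<close>; indeed \<open>exp 1\<close>
lies strictly between 2 and 3.\<close>

lemma ln_ln_nonzero:
  assumes "n \<ge> 2"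
  shows "ln (ln (real n)) \<noteq> 0"
proof
  assume "ln (ln (real n)) = 0"
  then have "ln (real n) = 1" using assms by (subst (asm) ln_eq_zero_iff) auto
  then have e: "real n = exp 1" using assms by (metis exp_ln of_nat_0_less_iff less_le_trans pos2)
  have "exp (1 :: real) < 3" using e_less_272 by simp
  then have "2 < n" "n < 3" using e exp_1_gt_2 by linarith+
  then show False by simp
qed

theorem theorem1p3:
  "\<exists>\<epsilon> :: nat \<Rightarrow> digraph \<Rightarrow> real.
     tendsto_zero_in_prob moran_forest \<epsilon> \<and>
     (\<forall>n\<ge>2. \<forall>F \<in> set_pmf (moran_forest n).
        real (max_tree_size n F) =
          moran_alpha * (ln (real n) - (1 + \<epsilon> n F) * ln (ln (real n))))"
proof (intro exI conjI)
  define \<epsilon> where "\<epsilon> n F = (ln (real n) - real (max_tree_size n F) / moran_alpha) / ln (ln (real n)) - 1"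
    for n :: nat and F
  show "\<forall>n\<ge>2. \<forall>F \<in> set_pmf (moran_forest n).
      real (max_tree_size n F) = moran_alpha * (ln (real n) - (1 + \<epsilon> n F) * ln (ln (real n)))"
    using ln_ln_nonzero alpha_pos by (auto simp: \<epsilon>_def field_simps)
  show "tendsto_zero_in_prob moran_forest \<epsilon>"
    unfolding tendsto_zero_in_prob_def
  proof (intro allI impI)
    fix \<delta> :: real assume \<delta>: "\<delta> > 0"
    let ?P = "\<lambda>n. measure_pmf.prob (moran_forest n)"
    let ?above = "\<lambda>n. {F. real (max_tree_size n F) > threshold (1 - \<delta>) (real n)}"
    let ?below = "\<lambda>n. {F. real (max_tree_size n F) < threshold (1 + \<delta>) (real n)}"
    have lim: "(\<lambda>n. ?P n (?above n) + ?P n (?below n)) \<longlonglongrightarrow> 0"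
      using tendsto_add[OF prob_above_threshold[OF \<delta>] prob_below_threshold[OF \<delta>]] by simp
    have "eventually (\<lambda>n. ln (ln (real n)) > 0) sequentially" by real_asymp
    then have "eventually (\<lambda>n. ?P n {F. \<bar>\<epsilon> n F\<bar> > \<delta>} \<le> ?P n (?above n) + ?P n (?below n)) sequentially"
    proof eventually_elim
      case (elim n)
      have "{F. \<bar>\<epsilon> n F\<bar> > \<delta>} \<subseteq> ?above n \<union> ?below n"
      proof
        fix F assume "F \<in> {F. \<bar>\<epsilon> n F\<bar> > \<delta>}"
        then have "\<epsilon> n F > \<delta> \<or> \<epsilon> n F < - \<delta>" by auto
        then show "F \<in> ?above n \<union> ?below n"
          using elim alpha_pos by (auto simp: \<epsilon>_def threshold_def field_simps)
      qed
      then have "?P n {F. \<bar>\<epsilon> n F\<bar> > \<delta>} \<le> ?P n (?above n \<union> ?below n)"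
        by (intro measure_pmf.finite_measure_mono) auto
      also have "\<dots> \<le> ?P n (?above n) + ?P n (?below n)"
        by (rule measure_Un_le) auto
      finally show ?case .
    qed
    then show "(\<lambda>n. ?P n {F. \<bar>\<epsilon> n F\<bar> > \<delta>}) \<longlonglongrightarrow> 0"
      by (intro tendsto_sandwich[OF _ _ tendsto_const lim]) auto
  qed
qed

end
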